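(* Let $n\ge1$ and let $\mathcal{A}\subset\mathbb{Z}_{\ge0}^{n}$ be a finite set whose associated projective variety $Y_{n,d_{\mathcal{A}}}\subset\mathbb{P}^{|\mathcal{A}|-1}$ has dimension $n$, and let $d=\deg(Y_{n,d_{\mathcal{A}}})$. (i) If $|\mathcal{A}|=n+1$, then $\varphi_{\mathcal{A}}(t)=p_{\mathcal{A}}(t)=\binom{t+n}{n}$ for all $t\ge0$. In particular $n_0(\mathcal{A})=0$. (ii) If $|\mathcal{A}|=n+2$, then $n_0(\mathcal{A})=d-n-1$ and $$\varphi_{\mathcal{A}}(t)=\begin{cases}\binom{t+n+1}{n+1} & \text{if } 0\le t<d-n-1,\\[4pt] \binom{t+n+1}{n+1}-\binom{t-d+n+1}{n+1} & \text{if } t\ge d-n-1.\end{cases}$$ Moreover $$d=\deg(Y_{n,d_{\mathcal{A}}})=n!\,\frac{\mathrm{vol}(\mathrm{conv}(\mathcal{A}))}{[\mathbb{Z}^n:\mathbb{Z}(\mathcal{A}-\mathcal{A})]}.$$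
   Context: $\mathbb{K}$ is an algebraically closed field of characteristic zero and $R=\mathbb{K}[x_0,\ldots,x_n]$. For $t\ge1$, $t\mathcal{A}=\{a_1+\cdots+a_t\mid a_i\in\mathcal{A}\}$ (repetitions allowed), $0\mathcal{A}=\{0\}$, and $\varphi_{\mathcal{A}}(t)=|t\mathcal{A}|$ for integers $t\ge0$. There is a polynomial $p_{\mathcal{A}}\in\mathbb{Q}[t]$ with $\varphi_{\mathcal{A}}(t)=p_{\mathcal{A}}(t)$ for $t\gg0$ (Khovanskii), and the phase transition is $n_0(\mathcal{A})=\min\{n_0\in\mathbb{Z}_{\ge0}\mid\varphi_{\mathcal{A}}(t)=p_{\mathcal{A}}(t)\ \forall t\ge n_0\}$. For a non-empty finite $\mathcal{A}\subset\mathbb{Z}_{\ge0}^n$ and $a\in\mathcal{A}$ put $|a|=a_1+\cdots+a_n$, and let $d_{\mathcal{A}}$ be the least integer $\delta\ge0$ with $|a|\le\delta$ for all $a\in\mathcal{A}$. The variety $Y_{n,d_{\mathcal{A}}}\subset\mathbb{P}^{|\mathcal{A}|-1}$ is the Zariski closure of the image of the rational map $\mathbb{P}^n\dashrightarrow\mathbb{P}^{|\mathcal{A}|-1}$ whose coordinates are the monomials $x_0^{d_{\mathcal{A}}-|a|}x_1^{a_1}\cdots x_n^{a_n}$, $a\in\mathcal{A}$. $\mathrm{conv}(\mathcal{A})\subset\mathbb{R}^n$ is the convex hull, $\mathrm{vol}$ is Euclidean volume, $\mathbb{Z}(\mathcal{A}-\mathcal{A})$ is the subgroup of $\mathbb{Z}^n$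 generated by the differences of elements of $\mathcal{A}$, and $[\mathbb{Z}^n:\mathbb{Z}(\mathcal{A}-\mathcal{A})]$ is its index.
   Formalization: In (ii), n_0(A) = d-n-1 is stated as n_0(A) = max(0, d-n-1), since n_0 is a minimum over nonnegative integers and d-n-1 can be negative (e.g. n=2, A={0,1}^2: d=2, n_0=0, but d-n-1=-1). *)

theory Defs
  imports
    "HOL-Analysis.Analysis"
    "HOL-Library.Poly_Mapping"
    "HOL-Computational_Algebra.Computational_Algebra"
    "HOL-Computational_Algebra.Group_Closure"
begin

section \<open>Sumsets\<close>

definition sumset :: "nat \<Rightarrow> 'a::monoid_add set \<Rightarrow> 'a set" where
  "sumset t A = {sum_list as | as. length as = t \<and> set as \<subseteq> A}"

definition sumset_card :: "'a::monoid_add set \<Rightarrow> nat \<Rightarrow> nat" where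
  "sumset_card A t = card (sumset t A)"

text \<open>
  A polynomial is determined by its values at all large natural numbers. For a finite set of
  lattice points such a polynomial exists by Khovanskii's theorem.
\<close>

definition sumset_poly :: "'a::monoid_add set \<Rightarrow> rat poly" where
  "sumset_poly A =
     (THE p. eventually (\<lambda>t. of_nat (sumset_card A t) = poly p (of_nat t)) sequentially)"

definition phase_transition :: "'a::monoid_add set \<Rightarrow> nat" where
  "phase_transition A =
     (LEAST n0. \<forall>t\<ge>n0. of_nat (sumset_card A t) = poly (sumset_poly A) (of_nat t))"


section \<open>Polynomials in several variables\<close>

text \<open>
  Polynomials with variables from \<open>'v\<close> and coefficients from \<open>'k\<close>; a monomial is given by its
  finitely supported exponent function. The ring structure is that of \<open>HOL-Library.Poly_Mapping\<close>.
\<close>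

type_synonym ('v, 'k) mpoly = "('v \<Rightarrow>\<^sub>0 nat) \<Rightarrow>\<^sub>0 'k"

definition mono_degree :: "('v \<Rightarrow>\<^sub>0 nat) \<Rightarrow> nat" where
  "mono_degree m = (\<Sum>v\<in>Poly_Mapping.keys m. Poly_Mapping.lookup m v)"

definition mpoly_eval :: "('v, 'k::comm_semiring_1) mpoly \<Rightarrow> ('v \<Rightarrow> 'k) \<Rightarrow> 'k" where
  "mpoly_eval f x = (\<Sum>m\<in>Poly_Mapping.keys f.
     Poly_Mapping.lookup f m * (\<Prod>v\<in>Poly_Mapping.keys m. x v ^ Poly_Mapping.lookup m v))"

text \<open>Forms of degree \<open>t\<close> in the variables \<open>V\<close>, including the zero polynomial.\<close>

definition forms :: "'v set \<Rightarrow> nat \<Rightarrow> ('v, 'k::comm_semiring_1) mpoly set" where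
  "forms V t = {f. \<forall>m\<in>Poly_Mapping.keys f. Poly_Mapping.keys m \<subseteq> V \<and> mono_degree m = t}"

definition mpoly_scale :: "'k::comm_semiring_1 \<Rightarrow> ('v, 'k) mpoly \<Rightarrow> ('v, 'k) mpoly" where
  "mpoly_scale c f = Poly_Mapping.single 0 c * f"

global_interpretation mpoly_vs:
  vector_space "mpoly_scale :: 'k::field \<Rightarrow> ('v, 'k) mpoly \<Rightarrow> ('v, 'k) mpoly"
  by standard
    (simp_all add: mpoly_scale_def distrib_left distrib_right single_add
      mult.assoc [symmetric] mult_single)


section \<open>Projective space and the Zariski topology\<close>

text \<open>
  The projective space with homogeneous coordinates indexed by a finite set \<open>V\<close>. A coordinate
  vector is a function vanishing outside \<open>V\<close>, and a point is the set of all nonzero multiples of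
  a nonzero coordinate vector.
\<close>

definition proj_point :: "('v \<Rightarrow> 'k::field) \<Rightarrow> ('v \<Rightarrow> 'k) set" where
  "proj_point x = {y. \<exists>c. c \<noteq> 0 \<and> y = (\<lambda>v. c * x v)}"

definition proj_space :: "'v set \<Rightarrow> ('v \<Rightarrow> 'k::field) set set" where
  "proj_space V = {proj_point x | x. (\<exists>v. x v \<noteq> 0) \<and> (\<forall>v. v \<notin> V \<longrightarrow> x v = 0)}"

definition vanishes_at :: "('v, 'k::field) mpoly \<Rightarrow> ('v \<Rightarrow> 'k) set \<Rightarrow> bool" where
  "vanishes_at f P \<longleftrightarrow> (\<forall>x\<in>P. mpoly_eval f x = 0)"

definition zariski_closed :: "'v set \<Rightarrow> ('v \<Rightarrow> 'k::field) set set \<Rightarrow> bool" where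
  "zariski_closed V Z \<longleftrightarrow>
     (\<exists>F. F \<subseteq> (\<Union>t. forms V t) \<and> Z = {P \<in> proj_space V. \<forall>f\<in>F. vanishes_at f P})"

definition zariski_closure ::
    "'v set \<Rightarrow> ('v \<Rightarrow> 'k::field) set set \<Rightarrow> ('v \<Rightarrow> 'k) set set" where
  "zariski_closure V S = zariski_closed V hull S"

definition irreducible_closed :: "'v set \<Rightarrow> ('v \<Rightarrow> 'k::field) set set \<Rightarrow> bool" where
  "irreducible_closed V Z \<longleftrightarrow> zariski_closed V Z \<and> Z \<noteq> {} \<and>
     (\<forall>Z1 Z2. zariski_closed V Z1 \<longrightarrow> zariski_closed V Z2 \<longrightarrow> Z = Z1 \<union> Z2 \<longrightarrow> Z = Z1 \<or> Z = Z2)"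

text \<open>
  The Krull dimension of a closed set \<open>Y\<close>. The empty set gets dimension 0 here, because the
  supremum is taken in \<open>enat\<close>.
\<close>

definition proj_dim :: "'v set \<Rightarrow> ('v \<Rightarrow> 'k::field) set set \<Rightarrow> enat" where
  "proj_dim V Y = Sup {enat k | k. \<exists>Z.
     (\<forall>i\<le>k. irreducible_closed V (Z i) \<and> Z i \<subseteq> Y) \<and> (\<forall>i<k. Z i \<subset> Z (Suc i))}"


section \<open>Hilbert polynomial and degree\<close>

definition vanishing_forms ::
    "'v set \<Rightarrow> ('v \<Rightarrow> 'k::field) set set \<Rightarrow> nat \<Rightarrow> ('v, 'k) mpoly set" where
  "vanishing_forms V Y t = {f \<in> forms V t. \<forall>P\<in>Y. vanishes_at f P}"

text \<open>
  The dimension of the degree \<open>t\<close> part of the homogeneous coordinate ring. For finite \<open>V\<close> both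
  spaces are finite-dimensional and the second is contained in the first.
\<close>

definition hilbert_function :: "'v set \<Rightarrow> ('v \<Rightarrow> 'k::field) set set \<Rightarrow> nat \<Rightarrow> nat" where
  "hilbert_function V Y t =
     mpoly_vs.dim (forms V t :: ('v, 'k) mpoly set) - mpoly_vs.dim (vanishing_forms V Y t)"

definition hilbert_poly :: "'v set \<Rightarrow> ('v \<Rightarrow> 'k::field) set set \<Rightarrow> rat poly" where
  "hilbert_poly V Y =
     (THE p. eventually (\<lambda>t. of_nat (hilbert_function V Y t) = poly p (of_nat t)) sequentially)"

definition proj_degree :: "'v set \<Rightarrow> ('v \<Rightarrow> 'k::field) set set \<Rightarrow> rat" where
  "proj_degree V Y =
     fact (Polynomial.degree (hilbert_poly V Y)) * lead_coeff (hilbert_poly V Y)"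


section \<open>The projective variety of a finite set of exponents\<close>

definition vec_total :: "nat ^ 'n \<Rightarrow> nat" where
  "vec_total a = (\<Sum>i\<in>UNIV. a $ i)"

definition max_total :: "(nat ^ 'n) set \<Rightarrow> nat" where
  "max_total A = (LEAST \<delta>. \<forall>a\<in>A. vec_total a \<le> \<delta>)"

text \<open>
  The homogeneous coordinates of the source space are indexed by \<open>'n option\<close>: \<open>None\<close> stands for
  the homogenizing variable \<open>x\<^sub>0\<close>, and \<open>Some i\<close> for the variable belonging to the \<open>i\<close>-th component
  of the exponent vectors. The target coordinates are indexed by the set \<open>A\<close> itself.
\<close>

definition monomial_map :: "(nat ^ 'n) set \<Rightarrow> ('n option \<Rightarrow> 'k::field) \<Rightarrow> nat ^ 'n \<Rightarrow> 'k" where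
  "monomial_map A x = (\<lambda>a. if a \<in> A
     then x None ^ (max_total A - vec_total a) * (\<Prod>i\<in>UNIV. x (Some i) ^ (a $ i)) else 0)"

definition monomial_variety :: "(nat ^ 'n) set \<Rightarrow> (nat ^ 'n \<Rightarrow> 'k::field) set set" where
  "monomial_variety A = zariski_closure A
     {proj_point (monomial_map A x) | x. (\<exists>j. x j \<noteq> 0) \<and> (\<exists>a. monomial_map A x a \<noteq> 0)}"


section \<open>Volume and lattice index\<close>

definition real_vec :: "nat ^ 'n \<Rightarrow> real ^ 'n" where
  "real_vec a = (\<chi> i. real (a $ i))"

definition int_vec :: "nat ^ 'n \<Rightarrow> int ^ 'n" where
  "int_vec a = (\<chi> i. int (a $ i))"

definition difference_group :: "(nat ^ 'n) set \<Rightarrow> (int ^ 'n) set" where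
  "difference_group A = group_closure {int_vec a - int_vec b | a b. a \<in> A \<and> b \<in> A}"

text \<open>As usual for \<open>card\<close>, an infinite index is represented by 0.\<close>

definition subgroup_index :: "'a::ab_group_add set \<Rightarrow> nat" where
  "subgroup_index H = card (UNIV // {(x, y). x - y \<in> H})"

end

theory Submission
  imports Defs
begin

text \<open>
  Write \<open>n\<close> for the dimension of the ambient lattice. The proof turns every quantity in the
  statement into a count of multisets over \<open>A\<close> or into the volume of a simplex with vertices in
  \<open>A\<close>.

  \<^item> A form of degree \<open>t\<close> vanishes on the monomial variety iff its coefficients sum to zero over
    every fibre of the map that sends a monomial in the coordinates \<open>a \<in> A\<close> to its exponent vector in
    \<open>tA\<close>, because distinct monomials are linearly independent as functions. Hence the Hilbert
    function of the variety is \<open>t \<mapsto> |tA|\<close> (\<open>hilbert_function_monomial_variety\<close>).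

  \<^item> If the variety has dimension \<open>n\<close>, then \<open>A\<close> affinely spans \<open>\<real>\<^sup>n\<close>
    (\<open>aff_dim_eq_if_proj_dim_eq\<close>). A form vanishing on one member of a chain of irreducible sets and
    not on the next is a nonzerodivisor there; multiplying by it shows that a chain of length \<open>n\<close>
    forces at least \<open>binomial (s + n) n\<close> independent forms in degree \<open>E s\<close>, for a constant \<open>E\<close>.
    But if \<open>A\<close> lies in a hyperplane, one coordinate of a point of \<open>tA\<close> is determined by the others,
    so \<open>|tA|\<close> grows at most like \<open>t\<close> to the power \<open>n - 1\<close>.

  \<^item> If \<open>A\<close> has \<open>n + 1\<close> points and spans, it is affinely independent, so distinct multisets have
    distinct sums and \<open>|tA|\<close> counts multisets. If it has \<open>n + 2\<close> points, the integer affine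
    relations form an infinite cyclic group, generated by some \<open>u\<close>. Let \<open>d\<close> be the sum of the
    positive entries of \<open>u\<close>. Each fibre of the sum map on multisets of size \<open>t\<close> contains exactly one
    multiset that does not include the positive part of \<open>u\<close>. So \<open>|tA|\<close> is the number of multisets of
    size \<open>t\<close> minus the number of multisets of size \<open>t - d\<close> (\<open>card_sumset\<close>). The resulting polynomial
    has leading coefficient \<open>d / n!\<close>, which makes \<open>d\<close> the degree. It agrees with \<open>|tA|\<close> for all
    \<open>t \<ge> d - n - 1\<close>, but not at \<open>t = d - n - 2\<close> when this is nonnegative: there its second binomial
    coefficient becomes \<open>binomial (-1) (n + 1) = \<plusminus>1\<close>.

  \<^item> The convex hull of \<open>A\<close> is triangulated by the simplices on \<open>A - {i}\<close> with \<open>u i > 0\<close>.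
    If \<open>m\<close> is the index of the difference group \<open>L\<close> of \<open>A\<close>, then the differences of \<open>A - {i}\<close>
    generate a subgroup of \<open>L\<close> of index \<open>\<bar>u i\<bar>\<close>, hence of \<open>\<int>\<^sup>n\<close> of index \<open>m \<bar>u i\<bar>\<close>.
    Two fundamental domains of one lattice have the same volume, so the simplex has volume
    \<open>m \<bar>u i\<bar> / n!\<close> (\<open>simplex_volume\<close>), and summing gives \<open>m d / n!\<close>.
\<close>

text \<open>Below, \<open>$\<close> denotes a component of a vector, never a coefficient of a power series.\<close>

no_notation fps_nth (infixl \<open>$\<close> 75)

section \<open>Sumsets and their growth\<close>

lemma sumset_eq_multisets:
  fixes A :: "'a::comm_monoid_add set"
  shows "sumset t A = sum_mset ` multisets_of_size A t"
proof (intro set_eqI iffI)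
  fix x assume "x \<in> sumset t A"
  then obtain as where as: "length as = t" "set as \<subseteq> A" "x = sum_list as"
    by (auto simp: sumset_def)
  then have "mset as \<in> multisets_of_size A t" "x = sum_mset (mset as)"
    by (auto simp: multisets_of_size_def sum_mset_sum_list)
  then show "x \<in> sum_mset ` multisets_of_size A t" by blast
next
  fix x assume "x \<in> sum_mset ` multisets_of_size A t"
  then obtain M where M: "M \<in> multisets_of_size A t" "x = sum_mset M" by blast
  obtain as where "M = mset as" by (metis ex_mset)
  with M show "x \<in> sumset t A"
    by (auto simp: multisets_of_size_def sumset_def sum_mset_sum_list)
qed

lemma finite_sumset:
  fixes A :: "'a::comm_monoid_add set"
  shows "finite A \<Longrightarrow> finite (sumset t A)"
  by (simp add: sumset_eq_multisets finite_multisets_of_size)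

lemma sum_mset_image_eq:
  fixes f :: "'a \<Rightarrow> nat"
  assumes "finite A" "set_mset M \<subseteq> A"
  shows "(\<Sum>a\<in>#M. f a) = (\<Sum>a\<in>A. count M a * f a)"
  using assms(2)
proof (induction M)
  case (add b M)
  have "(\<Sum>a\<in>A. count (add_mset b M) a * f a) = (\<Sum>a\<in>A. count M a * f a + (if a = b then f b else 0))"
    by (intro sum.cong) auto
  with add assms(1) show ?case by (simp add: sum.distrib)
qed simp

lemma sum_mset_component:
  fixes M :: "(nat ^ 'n) multiset"
  assumes "finite A" "set_mset M \<subseteq> A"
  shows "sum_mset M $ i = (\<Sum>a\<in>A. count M a * a $ i)"
proof -
  have "(\<Sum>a\<in>#N. a) $ i = (\<Sum>a\<in>#N. a $ i)" for N :: "(nat ^ 'n) multiset"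
    by (induction N) auto
  then have "sum_mset M $ i = (\<Sum>a\<in>#M. a $ i)" by simp
  also have "\<dots> = (\<Sum>a\<in>A. count M a * a $ i)"
    using assms by (rule sum_mset_image_eq)
  finally show ?thesis .
qed

lemma size_eq_sum_count:
  assumes "finite A" "set_mset M \<subseteq> A"
  shows "size M = (\<Sum>a\<in>A. count M a)"
  unfolding size_multiset_overloaded_eq
  using assms by (intro sum.mono_neutral_left) (auto simp: count_eq_zero_iff)

text \<open>
  Crude polynomial growth: the coordinates of a point of \<open>tA\<close> are at most \<open>t M\<close>, and only as many
  coordinates count as are needed to tell the points apart.
\<close>

lemma card_sumset_le_coordinates:
  fixes A :: "(nat ^ 'n) set"
  assumes "finite A" and bound: "\<And>a i. a \<in> A \<Longrightarrow> a $ i \<le> M"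
    and inj: "inj_on (\<lambda>x. restrict (vec_nth x) I) (sumset t A)"
  shows "card (sumset t A) \<le> (t * M + 1) ^ card I"
proof -
  have le: "x $ i \<le> t * M" if x: "x \<in> sumset t A" for x i
  proof -
    obtain as where as: "length as = t" "set as \<subseteq> A" "x = sum_list as"
      using x unfolding sumset_def by blast
    have "sum_list as $ i \<le> length as * M"
      using as(2) by (induction as) (auto simp: add_mono bound)
    then show ?thesis using as by simp
  qed
  have "card (sumset t A) \<le> card (Pi\<^sub>E I (\<lambda>_. {..t * M}))"
    by (rule card_inj_on_le[OF inj]) (auto simp: le intro!: finite_PiE)
  also have "\<dots> = (t * M + 1) ^ card I"
    by (simp add: card_PiE)
  finally show ?thesis .
qed

text \<open>
  The comparison behind both growth arguments: a polynomial of degree \<open>k\<close> in \<open>s\<close> cannot dominate a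
  binomial coefficient of degree \<open>k + 1\<close>.
\<close>

lemma power_less_binomial:
  "\<exists>s. (s * M + 1) ^ k < (s + (k + 1)) choose (k + 1)"
proof -
  \<comment> \<open>With this \<open>s\<close>, \<open>(s (M + 1)) ^ k\<close> and \<open>(s / (k + 1)) ^ (k + 1)\<close> coincide.\<close>
  define s where "s = (M + 1) ^ k * (k + 1) ^ (k + 1)"
  have s1: "s \<ge> 1" by (simp add: s_def Suc_le_eq)
  have "(s * M + 1) ^ k \<le> (s * (M + 1)) ^ k"
    using s1 by (intro power_mono) auto
  then have "real ((s * M + 1) ^ k) \<le> real (s * (M + 1)) ^ k"
    by (metis of_nat_le_iff of_nat_power)
  also have "\<dots> = real s ^ k * real ((M + 1) ^ k)"
    by (simp only: of_nat_mult power_mult_distrib of_nat_power)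
  also have "\<dots> = (real s / real (k + 1)) ^ (k + 1)"
  proof -
    have "real s = real ((M + 1) ^ k) * real (k + 1) ^ (k + 1)"
      unfolding s_def by (simp only: of_nat_mult of_nat_power)
    then have "real s ^ (k + 1) = real s ^ k * real ((M + 1) ^ k) * real (k + 1) ^ (k + 1)"
      by (simp only: power_add power_one_right mult.assoc)
    then show ?thesis unfolding power_divide
      by (simp only: nonzero_mult_div_cancel_right power_not_zero of_nat_eq_0_iff) simp
  qed
  also have "\<dots> < (real (s + (k + 1)) / real (k + 1)) ^ (k + 1)"
    by (intro power_strict_mono divide_strict_right_mono) auto
  also have "\<dots> \<le> real ((s + (k + 1)) choose (k + 1))"
    by (rule binomial_ge_n_over_k_pow_k) simp
  finally show ?thesis using of_nat_less_iff by blast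
qed

text \<open>
  All points of \<open>tA\<close> satisfy \<open>h \<bullet> x = t b\<close>, so a coordinate at which \<open>h\<close> does not vanish can be
  recovered from the remaining ones.
\<close>

lemma card_sumset_le_hyperplane:
  fixes A :: "(nat ^ 'n) set" and h :: "real ^ 'n"
  assumes "finite A" and bound: "\<And>a i. a \<in> A \<Longrightarrow> a $ i \<le> M"
    and "h \<noteq> 0" and hyp: "\<And>a. a \<in> A \<Longrightarrow> h \<bullet> real_vec a = b"
  shows "card (sumset t A) \<le> (t * M + 1) ^ (CARD('n) - 1)"
proof -
  obtain j where j: "h $ j \<noteq> 0" using \<open>h \<noteq> 0\<close> by (auto simp: vec_eq_iff)
  have on: "h \<bullet> real_vec x = t * b" if x: "x \<in> sumset t A" for x
  proof -
    obtain as where as: "length as = t" "set as \<subseteq> A" "x = sum_list as"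
      using x unfolding sumset_def by blast
    have [simp]: "real_vec 0 = 0" "real_vec (x + y) = real_vec x + real_vec y" for x y :: "nat ^ 'n"
      by (auto simp: real_vec_def vec_eq_iff)
    have "h \<bullet> real_vec (sum_list as) = length as * b"
      using as(2) by (induction as) (auto simp: hyp inner_add_right algebra_simps)
    then show ?thesis using as by simp
  qed
  have "inj_on (\<lambda>x. restrict (vec_nth x) (UNIV - {j})) (sumset t A)"
  proof (rule inj_onI)
    fix x y assume x: "x \<in> sumset t A" and y: "y \<in> sumset t A"
      and eq: "restrict (vec_nth x) (UNIV - {j}) = restrict (vec_nth y) (UNIV - {j})"
    have other: "x $ i = y $ i" if "i \<noteq> j" for i
      using fun_cong[OF eq, of i] that by simp
    have "(\<Sum>i\<in>UNIV. h $ i * real (x $ i)) = (\<Sum>i\<in>UNIV. h $ i * real (y $ i))"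
      using on[OF x] on[OF y] by (simp add: inner_vec_def real_vec_def)
    then have "h $ j * real (x $ j) = h $ j * real (y $ j)"
      by (subst (asm) (1 2) sum.remove[of _ j]) (auto simp: other)
    then show "x = y" using j other by (metis mult_cancel_left of_nat_eq_iff vec_eq_iff)
  qed
  from card_sumset_le_coordinates[OF \<open>finite A\<close> bound this]
  show ?thesis by (simp add: card_Diff_singleton)
qed

section \<open>Affine relations with integer coefficients\<close>

lemma inj_real_vec: "inj real_vec"
  by (auto simp: inj_def real_vec_def vec_eq_iff)

lemma affine_relation_eq_0:
  fixes A :: "(nat ^ 'n) set" and c :: "nat ^ 'n \<Rightarrow> real"
  assumes "finite A" "\<not> affine_dependent (real_vec ` A)"
    and "(\<Sum>a\<in>A. c a) = 0" "(\<Sum>a\<in>A. c a *\<^sub>R real_vec a) = 0" and "a \<in> A"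
  shows "c a = 0"
proof -
  have inj: "inj_on real_vec A" using inj_real_vec inj_on_subset by blast
  define U where "U = (\<lambda>v. c (inv real_vec v))"
  have U[simp]: "U (real_vec a) = c a" for a by (simp add: U_def inv_f_f inj_real_vec)
  have "sum U (real_vec ` A) = 0" "(\<Sum>v\<in>real_vec ` A. U v *\<^sub>R v) = 0"
    using assms(3,4) by (simp_all add: sum.reindex[OF inj] o_def)
  with assms(1,2) have "\<forall>v\<in>real_vec ` A. U v = 0"
    by (auto simp: affine_dependent_explicit_finite)
  then show ?thesis using \<open>a \<in> A\<close> by auto
qed

text \<open>
  Relations are extended by zero outside \<open>A\<close>, so that equality of relations is equality of functions.
\<close>

definition affine_relations :: "(nat ^ 'n) set \<Rightarrow> (nat ^ 'n \<Rightarrow> int) set" where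
  "affine_relations A = {v. (\<forall>a. a \<notin> A \<longrightarrow> v a = 0) \<and> (\<Sum>a\<in>A. v a) = 0
     \<and> (\<forall>i. (\<Sum>a\<in>A. v a * int (a $ i)) = 0)}"

lemma affine_relations_lincomb:
  assumes "v \<in> affine_relations A" "w \<in> affine_relations A"
  shows "(\<lambda>a. c * v a - d * w a) \<in> affine_relations A"
proof -
  have "(\<Sum>a\<in>A. (c * v a - d * w a) * int (a $ i))
      = c * (\<Sum>a\<in>A. v a * int (a $ i)) - d * (\<Sum>a\<in>A. w a * int (a $ i))" for i
    by (simp add: sum_distrib_left sum_subtractf algebra_simps)
  moreover have "(\<Sum>a\<in>A. (c * v a - d * w a)) = c * (\<Sum>a\<in>A. v a) - d * (\<Sum>a\<in>A. w a)"
    by (simp add: sum_distrib_left sum_subtractf)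
  ultimately show ?thesis using assms by (auto simp: affine_relations_def)
qed

lemma affine_relation_real:
  assumes "v \<in> affine_relations A"
  shows "(\<Sum>a\<in>A. real_of_int (v a)) = 0" "(\<Sum>a\<in>A. real_of_int (v a) *\<^sub>R real_vec a) = 0"
proof -
  show "(\<Sum>a\<in>A. real_of_int (v a)) = 0"
    using assms by (simp add: affine_relations_def flip: of_int_sum)
  have "(\<Sum>a\<in>A. real_of_int (v a) * real (a $ i)) = of_int (\<Sum>a\<in>A. v a * int (a $ i))" for i
    by simp
  then show "(\<Sum>a\<in>A. real_of_int (v a) *\<^sub>R real_vec a) = 0"
    using assms by (simp add: vec_eq_iff real_vec_def affine_relations_def del: of_int_sum of_int_mult)
qed

text \<open>
  Coincidences among sums of multisets are the same thing as integer affine relations.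
\<close>

lemma count_diff_affine_relation:
  assumes "finite A" "M \<in> multisets_of_size A t" "N \<in> multisets_of_size A t"
    and "sum_mset M = sum_mset N"
  shows "(\<lambda>a. int (count M a) - int (count N a)) \<in> affine_relations A"
proof -
  have sub: "set_mset M \<subseteq> A" "set_mset N \<subseteq> A" and sz: "size M = size N"
    using assms(2,3) by (auto simp: multisets_of_size_def)
  have "(\<Sum>a\<in>A. (int (count M a) - int (count N a)) * int (a $ i)) = 0" for i
  proof -
    have "int (sum_mset M $ i) = int (sum_mset N $ i)" using assms(4) by simp
    then show ?thesis
      unfolding sum_mset_component[OF assms(1) sub(1)] sum_mset_component[OF assms(1) sub(2)]
      by (simp add: left_diff_distrib sum_subtractf)
  qed
  moreover have "(\<Sum>a\<in>A. int (count M a) - int (count N a)) = 0"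
    using sz unfolding size_eq_sum_count[OF assms(1) sub(1)] size_eq_sum_count[OF assms(1) sub(2)]
    by (simp add: sum_subtractf flip: of_nat_sum)
  moreover have "int (count M a) - int (count N a) = 0" if "a \<notin> A" for a
    using sub that by (metis count_eq_zero_iff diff_self of_nat_0 subset_iff)
  ultimately show ?thesis by (auto simp: affine_relations_def)
qed

lemma card_sumset_if_affine_independent:
  assumes "finite A" "\<not> affine_dependent (real_vec ` A)" "card A = CARD('n) + 1"
  shows "card (sumset t (A :: (nat ^ 'n) set)) = (t + CARD('n)) choose CARD('n)"
proof -
  have "inj_on sum_mset (multisets_of_size A t)"
  proof (rule inj_onI)
    fix M N assume MN: "M \<in> multisets_of_size A t" "N \<in> multisets_of_size A t" "sum_mset M = sum_mset N"
    let ?v = "\<lambda>a. int (count M a) - int (count N a)"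
    have v: "?v \<in> affine_relations A"
      using count_diff_affine_relation[OF assms(1)] MN by blast
    have "?v a = 0" for a
      using affine_relation_eq_0[OF assms(1,2) affine_relation_real[OF v], of a] v
      by (cases "a \<in> A") (auto simp: affine_relations_def)
    then show "M = N" by (intro multiset_eqI) (metis eq_iff_diff_eq_0 of_nat_eq_iff)
  qed
  then have "card (sumset t A) = card (multisets_of_size A t)"
    by (simp add: sumset_eq_multisets card_image)
  also have "\<dots> = (t + CARD('n)) choose t"
    using assms by (simp add: card_multisets_of_size add.commute)
  also have "\<dots> = (t + CARD('n)) choose CARD('n)"
    by (subst binomial_symmetric) auto
  finally show ?thesis .
qed

text \<open>
  By pigeonhole: once \<open>s\<close> is large, there are more multisets of size \<open>s\<close> than points available for
  their sums, and two multisets with the same sum differ by a relation with integer coefficients.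
\<close>

lemma nonzero_affine_relation:
  fixes A :: "(nat ^ 'n) set"
  assumes "finite A" "card A = CARD('n) + 2"
  obtains u where "u \<in> affine_relations A" "u \<noteq> (\<lambda>_. 0)"
proof -
  define M where "M = Max (insert 0 (\<Union>a\<in>A. range (vec_nth a)))"
  have M: "a $ i \<le> M" if "a \<in> A" for a i
    unfolding M_def by (rule Max_ge) (use assms(1) that in auto)
  obtain s where s: "(s * M + 1) ^ CARD('n) < (s + (CARD('n) + 1)) choose (CARD('n) + 1)"
    using power_less_binomial by blast
  have "card (sumset s A) \<le> (s * M + 1) ^ CARD('n)"
    by (rule card_sumset_le_coordinates[where I=UNIV]) (auto simp: assms M inj_on_def vec_eq_iff fun_eq_iff)
  also note s
  also have "(s + (CARD('n) + 1)) choose (CARD('n) + 1) = (s + (CARD('n) + 1)) choose s"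
    by (subst binomial_symmetric) auto
  also have "\<dots> = card (multisets_of_size A s)"
    using assms by (simp add: card_multisets_of_size add.commute)
  finally have "card (sum_mset ` multisets_of_size A s) < card (multisets_of_size A s)"
    by (simp add: sumset_eq_multisets)
  then have "\<not> inj_on sum_mset (multisets_of_size A s)"
    by (metis card_image less_irrefl)
  then obtain N N' where N: "N \<in> multisets_of_size A s" "N' \<in> multisets_of_size A s"
    "sum_mset N = sum_mset N'" "N \<noteq> N'" by (auto simp: inj_on_def)
  show ?thesis
  proof
    show "(\<lambda>a. int (count N a) - int (count N' a)) \<in> affine_relations A"
      using count_diff_affine_relation[OF assms(1)] N by blast
    show "(\<lambda>a. int (count N a) - int (count N' a)) \<noteq> (\<lambda>_. 0)"
      using N(4) by (auto simp: fun_eq_iff multiset_eq_iff)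
  qed
qed

text \<open>
  A point with a nonzero coefficient in a relation is an affine combination of the others. Hence the
  remaining \<open>n + 1\<close> points still span, and \<open>n + 1\<close> spanning points are independent.
\<close>

lemma affine_independent_remove:
  fixes A :: "(nat ^ 'n) set"
  assumes "finite A" "card A = CARD('n) + 2" "aff_dim (real_vec ` A) = CARD('n)"
    and "u \<in> affine_relations A" "u b \<noteq> 0"
  shows "\<not> affine_dependent (real_vec ` (A - {b}))"
proof -
  have inj: "inj_on real_vec S" for S :: "(nat ^ 'n) set" using inj_real_vec inj_on_subset by blast
  have b: "b \<in> A" using assms(4,5) by (auto simp: affine_relations_def)
  note r = affine_relation_real[OF assms(4)]
  define U where "U = (\<lambda>a. - real_of_int (u a) / real_of_int (u b))"
  have "(\<Sum>a\<in>A - {b}. real_of_int (u a)) = - real_of_int (u b)"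
    using r(1) b assms(1) by (simp add: sum.remove)
  then have U1: "(\<Sum>a\<in>A - {b}. U a) = 1"
    using assms(5) by (simp add: U_def sum_negf flip: sum_divide_distrib)
  have "(\<Sum>a\<in>A - {b}. real_of_int (u a) *\<^sub>R real_vec a) = - (real_of_int (u b) *\<^sub>R real_vec b)"
    using r(2) b assms(1) by (simp add: sum.remove add_eq_0_iff)
  moreover have "(\<Sum>a\<in>A - {b}. U a *\<^sub>R real_vec a)
      = (- 1 / real_of_int (u b)) *\<^sub>R (\<Sum>a\<in>A - {b}. real_of_int (u a) *\<^sub>R real_vec a)"
    by (simp add: U_def scaleR_sum_right)
  ultimately have U2: "(\<Sum>a\<in>A - {b}. U a *\<^sub>R real_vec a) = real_vec b"
    using assms(5) by simp
  define W where "W = (\<lambda>v. U (inv real_vec v))"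
  have [simp]: "W (real_vec a) = U a" for a by (simp add: W_def inv_f_f inj_real_vec)
  have "real_vec b \<in> affine hull (real_vec ` (A - {b}))"
    using assms(1) U1 U2
    by (subst affine_hull_finite) (auto simp: sum.reindex[OF inj] intro!: exI[of _ W])
  then have "affine hull (insert (real_vec b) (real_vec ` (A - {b}))) = affine hull (real_vec ` (A - {b}))"
    by (rule hull_redundant)
  moreover have "insert (real_vec b) (real_vec ` (A - {b})) = real_vec ` A" using b by auto
  ultimately have "aff_dim (real_vec ` (A - {b})) = CARD('n)"
    using assms(3) by (metis aff_dim_affine_hull)
  then show ?thesis
    using assms(1,2) b by (simp add: affine_independent_iff_card card_image[OF inj])
qed

lemma affine_relation_zero_if_vanishing_at:
  fixes A :: "(nat ^ 'n) set"
  assumes "finite A" "\<not> affine_dependent (real_vec ` (A - {b}))" "v \<in> affine_relations A" "v b = 0"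
  shows "v = (\<lambda>_. 0)"
proof
  fix a
  note r = affine_relation_real[OF assms(3)]
  have z: "(\<Sum>a\<in>A - {b}. real_of_int (v a)) = 0" "(\<Sum>a\<in>A - {b}. real_of_int (v a) *\<^sub>R real_vec a) = 0"
    using r assms(1,4) by (cases "b \<in> A"; simp add: sum.remove)+
  show "v a = 0"
    using affine_relation_eq_0[OF _ assms(2) z, of a] assms by (auto simp: affine_relations_def)
qed

text \<open>
  Choose a relation whose coefficient at some point \<open>b\<close> is nonzero of least absolute value. Division
  with remainder at \<open>b\<close> turns any other relation into one vanishing at \<open>b\<close>, and this one is zero by
  affine independence of \<open>A - {b}\<close>.
\<close>

lemma affine_relations_generator:
  fixes A :: "(nat ^ 'n) set"
  assumes "finite A" "card A = CARD('n) + 2" "aff_dim (real_vec ` A) = CARD('n)"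
  obtains u where "u \<in> affine_relations A" "u \<noteq> (\<lambda>_. 0)"
    "\<And>v. v \<in> affine_relations A \<Longrightarrow> \<exists>q. v = (\<lambda>a. q * u a)"
proof -
  obtain w where w: "w \<in> affine_relations A" "w \<noteq> (\<lambda>_. 0)"
    using nonzero_affine_relation[OF assms(1,2)] .
  then obtain b where b: "w b \<noteq> 0" by (auto simp: fun_eq_iff)
  define P where "P = (\<lambda>v. v \<in> affine_relations A \<and> v b \<noteq> 0)"
  have Pw: "P w" using w b by (simp add: P_def)
  obtain u where u: "P u" and min: "\<And>v. P v \<Longrightarrow> nat \<bar>u b\<bar> \<le> nat \<bar>v b\<bar>"
    using ex_has_least_nat[of P w "\<lambda>v. nat \<bar>v b\<bar>", OF Pw] by auto
  have indep: "\<not> affine_dependent (real_vec ` (A - {b}))"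
    using u affine_independent_remove[OF assms, of u b] by (simp add: P_def)
  show ?thesis
  proof
    show "u \<in> affine_relations A" "u \<noteq> (\<lambda>_. 0)" using u by (auto simp: P_def)
    fix v assume v: "v \<in> affine_relations A"
    define r where "r = (\<lambda>a. v a - (v b div u b) * u a)"
    have r: "r \<in> affine_relations A"
      using affine_relations_lincomb[OF v, of u 1 "v b div u b"] u by (simp add: r_def P_def)
    have "r b = v b mod u b" by (simp add: r_def minus_div_mult_eq_mod)
    then have "nat \<bar>r b\<bar> < nat \<bar>u b\<bar>" using u abs_mod_less[of "u b" "v b"] by (simp add: P_def)
    then have "r b = 0" using min[of r] r by (meson P_def not_le)
    then have "r = (\<lambda>_. 0)"
      by (rule affine_relation_zero_if_vanishing_at[OF assms(1) indep r])
    then have "v a = (v b div u b) * u a" for a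
      by (metis r_def eq_iff_diff_eq_0)
    then show "\<exists>q. v = (\<lambda>a. q * u a)" by blast
  qed
qed

section \<open>Sumsets of \<open>n + 2\<close> spanning points\<close>

locale single_relation =
  fixes A :: "(nat ^ 'n) set" and u :: "nat ^ 'n \<Rightarrow> int"
  assumes finite_A: "finite A" and card_A: "card A = CARD('n) + 2"
    and full_dim: "aff_dim (real_vec ` A) = CARD('n)"
    and u_rel: "u \<in> affine_relations A" and u_nonzero: "u \<noteq> (\<lambda>_. 0)"
    and u_generates: "\<And>v. v \<in> affine_relations A \<Longrightarrow> \<exists>q. v = (\<lambda>a. q * u a)"
begin

definition pos_part :: "(nat ^ 'n) multiset" where
  "pos_part = (\<Sum>a\<in>A. replicate_mset (nat (u a)) a)"

definition neg_part :: "(nat ^ 'n) multiset" where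
  "neg_part = (\<Sum>a\<in>A. replicate_mset (nat (- u a)) a)"

definition relation_degree :: nat where
  "relation_degree = (\<Sum>a\<in>A. nat (u a))"

lemma u_outside: "a \<notin> A \<Longrightarrow> u a = 0"
  using u_rel by (simp add: affine_relations_def)

lemma count_parts: "count pos_part a = nat (u a)" "count neg_part a = nat (- u a)"
  using finite_A u_outside[of a] by (auto simp: pos_part_def neg_part_def count_sum)

lemma set_parts: "set_mset pos_part \<subseteq> A" "set_mset neg_part \<subseteq> A"
  using u_outside by (auto simp: count_parts simp flip: count_greater_zero_iff) force+

lemma size_pos_part: "size pos_part = relation_degree"
  using size_eq_sum_count[OF finite_A set_parts(1)] by (simp add: count_parts relation_degree_def)

lemma size_parts: "size neg_part = size pos_part"
proof -
  have "int (nat (u a)) - int (nat (- u a)) = u a" for a by simp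
  then have "(\<Sum>a\<in>A. int (nat (u a))) - (\<Sum>a\<in>A. int (nat (- u a))) = (\<Sum>a\<in>A. u a)"
    by (simp only: flip: sum_subtractf)
  also have "\<dots> = 0" using u_rel by (simp add: affine_relations_def)
  finally show ?thesis
    unfolding size_eq_sum_count[OF finite_A set_parts(1)] size_eq_sum_count[OF finite_A set_parts(2)]
    by (simp only: sum.cong[OF refl count_parts(1)] sum.cong[OF refl count_parts(2)] of_nat_sum[symmetric] of_nat_eq_iff right_minus_eq)
qed

lemma sum_parts: "sum_mset neg_part = sum_mset pos_part"
proof -
  have "sum_mset neg_part $ i = sum_mset pos_part $ i" for i
  proof -
    have "int (nat (u a)) * int (a $ i) - int (nat (- u a)) * int (a $ i) = u a * int (a $ i)" for a
      by (simp flip: left_diff_distrib)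
    then have "(\<Sum>a\<in>A. int (nat (u a)) * int (a $ i)) - (\<Sum>a\<in>A. int (nat (- u a)) * int (a $ i))
        = (\<Sum>a\<in>A. u a * int (a $ i))"
      by (simp only: flip: sum_subtractf)
    also have "\<dots> = 0" using u_rel by (simp add: affine_relations_def)
    finally show ?thesis
      unfolding sum_mset_component[OF finite_A set_parts(1)] sum_mset_component[OF finite_A set_parts(2)]
      by (simp only: count_parts of_nat_sum[symmetric] of_nat_mult[symmetric] of_nat_eq_iff right_minus_eq)
  qed
  then show ?thesis by (simp add: vec_eq_iff)
qed

lemma ex_positive: obtains a where "a \<in> A" "u a > 0"
proof -
  have "\<exists>a\<in>A. u a > 0"
  proof (rule ccontr)
    assume "\<not> ?thesis"
    then have "\<forall>a\<in>A. - u a \<ge> 0" by force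
    moreover have "(\<Sum>a\<in>A. - u a) = 0" using u_rel by (simp add: affine_relations_def sum_negf)
    ultimately have "\<forall>a\<in>A. - u a = 0"
      by (subst (asm) sum_nonneg_eq_0_iff) (auto simp: finite_A)
    then show False using u_nonzero u_outside by fastforce
  qed
  with that show ?thesis by blast
qed

lemma relation_degree_pos: "relation_degree > 0"
proof -
  obtain a where "a \<in> A" "u a > 0" by (rule ex_positive)
  then show ?thesis unfolding relation_degree_def
    by (intro sum_pos2[OF finite_A, of a]) auto
qed

text \<open>
  Two multisets with equal sums differ by a multiple \<open>q u\<close>. If \<open>q > 0\<close>, then \<open>M\<close> has multiplicity at
  least \<open>q u a \<ge> u a\<close> at every point \<open>a\<close> where \<open>u\<close> is positive, and so includes \<open>pos_part\<close>; if
  \<open>q < 0\<close>, the same holds for \<open>N\<close>.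
\<close>

lemma eq_if_not_divisible:
  assumes "M \<in> multisets_of_size A t" "N \<in> multisets_of_size A t" "sum_mset M = sum_mset N"
    and "\<not> pos_part \<subseteq># M" "\<not> pos_part \<subseteq># N"
  shows "M = N"
proof -
  obtain q where "(\<lambda>a. int (count M a) - int (count N a)) = (\<lambda>a. q * u a)"
    using u_generates[OF count_diff_affine_relation[OF finite_A assms(1-3)]] by blast
  then have q: "int (count M a) = int (count N a) + q * u a" for a
    by (metis add_diff_cancel_left' diff_add_cancel add.commute)
  have "q = 0"
  proof (rule ccontr)
    assume "q \<noteq> 0"
    then consider "q \<ge> 1" | "q \<le> -1" by linarith
    then show False
    proof cases
      case 1
      have "nat (u a) \<le> count M a" for a
      proof (cases "u a > 0")
        case True
        then have "u a \<le> q * u a" using 1 by simp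
        then show ?thesis using q[of a] by linarith
      qed simp
      then show False using assms(4) by (auto simp: subseteq_mset_def count_parts)
    next
      case 2
      have "nat (u a) \<le> count N a" for a
      proof (cases "u a > 0")
        case True
        then have "1 * u a \<le> (- q) * u a" using 2 by (intro mult_right_mono) auto
        then show ?thesis using q[of a] by simp
      qed simp
      then show False using assms(5) by (auto simp: subseteq_mset_def count_parts)
    qed
  qed
  then show ?thesis using q by (intro multiset_eqI) auto
qed

text \<open>
  Replacing \<open>pos_part\<close> by \<open>neg_part\<close> preserves size and sum and lowers the number of elements at
  which \<open>u\<close> is positive, so a multiset minimizing that number cannot include \<open>pos_part\<close>.
\<close>

lemma ex_not_divisible:
  assumes "x \<in> sumset t A"
  shows "\<exists>M\<in>multisets_of_size A t. \<not> pos_part \<subseteq># M \<and> sum_mset M = x"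
proof -
  define P where "P = (\<lambda>M. M \<in> multisets_of_size A t \<and> sum_mset M = x)"
  \<comment> \<open>Exchanging the parts of \<open>u\<close> lowers this number by \<open>relation_degree\<close>.\<close>
  define weight where "weight = (\<lambda>M. size (filter_mset (\<lambda>a. u a > 0) M))"
  obtain M0 where "P M0" using assms by (auto simp: sumset_eq_multisets P_def)
  then obtain M where M: "P M" and min: "\<And>N. P N \<Longrightarrow> weight M \<le> weight N"
    using ex_has_least_nat[of P M0 weight, OF \<open>P M0\<close>] by auto
  have "\<not> pos_part \<subseteq># M"
  proof
    assume "pos_part \<subseteq># M"
    then obtain N where N: "M = pos_part + N" by (metis subset_mset.le_iff_add)
    have "P (neg_part + N)"
      using M set_parts(2) by (auto simp: P_def N multisets_of_size_def size_parts sum_parts)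
    from min[OF this] have "weight pos_part \<le> weight neg_part"
      by (simp add: N weight_def)
    moreover have "filter_mset (\<lambda>a. u a > 0) pos_part = pos_part"
      by (intro multiset_eqI) (simp add: count_parts)
    moreover have "filter_mset (\<lambda>a. u a > 0) neg_part = {#}"
      by (intro multiset_eqI) (simp add: count_parts)
    ultimately show False using relation_degree_pos by (simp add: weight_def size_pos_part)
  qed
  with M show ?thesis by (auto simp: P_def)
qed

text \<open>
  The multisets not including \<open>pos_part\<close> are a system of representatives for the sums, and those
  including it are translates of multisets of size \<open>t - relation_degree\<close>. Truncated subtraction makes
  one formula cover all \<open>t\<close>: for \<open>t < relation_degree\<close> the upper entry of the second binomial
  coefficient is below \<open>n + 1\<close>.
\<close>

theorem card_sumset:
  "card (sumset t A) = ((t + CARD('n) + 1) choose (CARD('n) + 1))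
      - ((t + CARD('n) + 1 - relation_degree) choose (CARD('n) + 1))"
  "((t + CARD('n) + 1 - relation_degree) choose (CARD('n) + 1)) \<le> ((t + CARD('n) + 1) choose (CARD('n) + 1))"
proof -
  let ?n = "CARD('n)"
  let ?D = "{M \<in> multisets_of_size A t. pos_part \<subseteq># M}"
  have num: "card (multisets_of_size A s) = (s + ?n + 1) choose (?n + 1)" for s
  proof -
    have "card (multisets_of_size A s) = (s + ?n + 1) choose s"
      using finite_A card_A by (simp add: card_multisets_of_size add.commute)
    also have "\<dots> = (s + ?n + 1) choose (?n + 1)"
      by (subst binomial_symmetric) auto
    finally show ?thesis .
  qed
  have "bij_betw sum_mset (multisets_of_size A t - ?D) (sumset t A)"
    unfolding bij_betw_def
  proof (intro conjI inj_onI equalityI)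
    show "M = N" if "M \<in> multisets_of_size A t - ?D" "N \<in> multisets_of_size A t - ?D"
      "sum_mset M = sum_mset N" for M N
      using that eq_if_not_divisible[of M t N] by blast
    show "sum_mset ` (multisets_of_size A t - ?D) \<subseteq> sumset t A"
      unfolding sumset_eq_multisets by blast
    show "sumset t A \<subseteq> sum_mset ` (multisets_of_size A t - ?D)"
      using ex_not_divisible by fast
  qed
  then have "card (sumset t A) = card (multisets_of_size A t - ?D)"
    by (rule bij_betw_same_card[symmetric])
  also have "\<dots> = card (multisets_of_size A t) - card ?D"
    by (rule card_Diff_subset) (simp_all add: finite_A finite_multisets_of_size)
  also have D: "card ?D = ((t + ?n + 1 - relation_degree) choose (?n + 1))"
  proof (cases "relation_degree \<le> t")
    case True
    have "?D = (\<lambda>N. pos_part + N) ` multisets_of_size A (t - relation_degree)"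
    proof (intro set_eqI iffI)
      fix M assume "M \<in> ?D"
      then obtain N where "M = pos_part + N" "M \<in> multisets_of_size A t"
        by (auto simp: subset_mset.le_iff_add)
      then show "M \<in> (\<lambda>N. pos_part + N) ` multisets_of_size A (t - relation_degree)"
        by (auto simp: multisets_of_size_def size_pos_part)
    next
      fix M assume "M \<in> (\<lambda>N. pos_part + N) ` multisets_of_size A (t - relation_degree)"
      then show "M \<in> ?D"
        using True set_parts(1) by (auto simp: multisets_of_size_def size_pos_part)
    qed
    then have "card ?D = card (multisets_of_size A (t - relation_degree))"
      by (simp add: card_image inj_on_def)
    moreover have "t - relation_degree + ?n + 1 = t + ?n + 1 - relation_degree" using True by simp
    ultimately show ?thesis by (simp only: num)
  next
    case False
    have "?D = {}"
      using False by (auto simp: multisets_of_size_def size_pos_part dest!: size_mset_mono)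
    then have "card ?D = 0" by (simp only: card.empty)
    moreover have "((t + ?n + 1 - relation_degree) choose (?n + 1)) = 0"
      using False by (intro binomial_eq_0) simp
    ultimately show ?thesis by (simp only:)
  qed
  finally show "card (sumset t A) = ((t + ?n + 1) choose (?n + 1))
      - ((t + ?n + 1 - relation_degree) choose (?n + 1))"
    by (simp only: num)
  have "card ?D \<le> card (multisets_of_size A t)"
    by (rule card_mono[OF finite_multisets_of_size[OF finite_A]]) blast
  then show "((t + ?n + 1 - relation_degree) choose (?n + 1)) \<le> ((t + ?n + 1) choose (?n + 1))"
    by (simp only: D num)
qed

end

section \<open>Evaluating forms\<close>

definition mono_eval :: "('v \<Rightarrow>\<^sub>0 nat) \<Rightarrow> ('v \<Rightarrow> 'k::comm_semiring_1) \<Rightarrow> 'k" where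
  "mono_eval m x = (\<Prod>v\<in>Poly_Mapping.keys m. x v ^ Poly_Mapping.lookup m v)"

definition monomials :: "'v set \<Rightarrow> nat \<Rightarrow> ('v \<Rightarrow>\<^sub>0 nat) set" where
  "monomials V t = {m. Poly_Mapping.keys m \<subseteq> V \<and> mono_degree m = t}"

lemma forms_iff: "f \<in> forms V t \<longleftrightarrow> Poly_Mapping.keys f \<subseteq> monomials V t"
  by (auto simp: forms_def monomials_def)

lemma mono_eval_superset:
  assumes "finite V" "Poly_Mapping.keys m \<subseteq> V"
  shows "mono_eval m x = (\<Prod>v\<in>V. x v ^ Poly_Mapping.lookup m v)"
  unfolding mono_eval_def using assms
  by (intro prod.mono_neutral_left) (auto simp: in_keys_iff)

lemma mono_degree_superset:
  assumes "finite V" "Poly_Mapping.keys m \<subseteq> V"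
  shows "mono_degree m = (\<Sum>v\<in>V. Poly_Mapping.lookup m v)"
  unfolding mono_degree_def using assms
  by (intro sum.mono_neutral_left) (auto simp: in_keys_iff)

lemma mpoly_eval_superset:
  assumes "finite S" "Poly_Mapping.keys f \<subseteq> S"
  shows "mpoly_eval f x = (\<Sum>m\<in>S. Poly_Mapping.lookup f m * mono_eval m x)"
  unfolding mpoly_eval_def mono_eval_def using assms
  by (intro sum.mono_neutral_left) (auto simp: in_keys_iff)

lemma keys_add_nat: "Poly_Mapping.keys (m + m') = Poly_Mapping.keys m \<union> Poly_Mapping.keys (m' :: 'v \<Rightarrow>\<^sub>0 nat)"
  by (auto simp: in_keys_iff lookup_add)

lemma mono_eval_add: "mono_eval (m + m') x = mono_eval m x * mono_eval m' x"
proof -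
  let ?V = "Poly_Mapping.keys m \<union> Poly_Mapping.keys m'"
  show ?thesis
    by (subst (1 2 3) mono_eval_superset[of ?V])
      (auto simp: keys_add_nat lookup_add power_add prod.distrib)
qed

lemma mono_degree_add: "mono_degree (m + m') = mono_degree m + mono_degree m'"
proof -
  let ?V = "Poly_Mapping.keys m \<union> Poly_Mapping.keys m'"
  show ?thesis
    by (subst (1 2 3) mono_degree_superset[of ?V])
      (auto simp: keys_add_nat lookup_add sum.distrib)
qed

lemma mono_eval_scale: "mono_eval m (\<lambda>v. c * x v) = c ^ mono_degree m * mono_eval m x"
  by (simp add: mono_eval_def mono_degree_def power_mult_distrib prod.distrib power_sum)

lemma lookup_mpoly_scale [simp]:
  "Poly_Mapping.lookup (mpoly_scale c f) m = c * Poly_Mapping.lookup f m"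
  by (simp add: mpoly_scale_def flip: mult_map_scale_conv_mult) (simp add: map.rep_eq when_def)

lemma keys_mpoly_scale: "Poly_Mapping.keys (mpoly_scale c f) \<subseteq> Poly_Mapping.keys f"
  by (auto simp: in_keys_iff)

lemma mpoly_eval_add: "mpoly_eval (f + g) x = mpoly_eval f x + mpoly_eval g x"
proof -
  let ?S = "Poly_Mapping.keys f \<union> Poly_Mapping.keys g"
  show ?thesis
    by (subst (1 2 3) mpoly_eval_superset[of ?S])
      (auto simp: lookup_add distrib_right sum.distrib dest: subsetD[OF keys_add])
qed

lemma mpoly_eval_mpoly_scale: "mpoly_eval (mpoly_scale c f) x = c * mpoly_eval f x"
  by (subst (1 2) mpoly_eval_superset[of "Poly_Mapping.keys f"])
    (auto simp: sum_distrib_left mult.assoc dest: subsetD[OF keys_mpoly_scale])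

lemma mpoly_eval_0 [simp]: "mpoly_eval 0 x = 0"
  by (simp add: mpoly_eval_def)

lemma mpoly_eval_sum: "mpoly_eval (sum f S) x = (\<Sum>i\<in>S. mpoly_eval (f i) x)"
  by (induction S rule: infinite_finite_induct) (auto simp: mpoly_eval_add)

lemma mpoly_eval_single: "mpoly_eval (Poly_Mapping.single m c) x = c * mono_eval m x"
  by (subst mpoly_eval_superset[of "{m}"]) (auto split: if_splits)

lemma mpoly_eq_sum_singles:
  assumes "finite S" "Poly_Mapping.keys f \<subseteq> S"
  shows "f = (\<Sum>m\<in>S. Poly_Mapping.single m (Poly_Mapping.lookup f m))"
proof (rule poly_mapping_eqI)
  fix k
  show "Poly_Mapping.lookup f k = Poly_Mapping.lookup (\<Sum>m\<in>S. Poly_Mapping.single m (Poly_Mapping.lookup f m)) k"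
    using assms by (auto simp: lookup_sum lookup_single when_def in_keys_iff)
qed

lemma mpoly_eval_mult: "mpoly_eval (f * g) x = mpoly_eval f x * mpoly_eval g x"
proof -
  let ?F = "Poly_Mapping.keys f" and ?G = "Poly_Mapping.keys g"
  have "f * g = (\<Sum>m\<in>?F. Poly_Mapping.single m (Poly_Mapping.lookup f m))
      * (\<Sum>m\<in>?G. Poly_Mapping.single m (Poly_Mapping.lookup g m))"
    using mpoly_eq_sum_singles[of ?F f] mpoly_eq_sum_singles[of ?G g] by simp
  then have "mpoly_eval (f * g) x = (\<Sum>m\<in>?F. \<Sum>m'\<in>?G.
      Poly_Mapping.lookup f m * Poly_Mapping.lookup g m' * mono_eval (m + m') x)"
    by (simp only: sum_product mult_single mpoly_eval_sum mpoly_eval_single)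
  also have "\<dots> = mpoly_eval f x * mpoly_eval g x"
    by (subst (1 2) mpoly_eval_superset[OF finite_keys order_refl])
      (simp add: sum_product mono_eval_add mult_ac)
  finally show ?thesis .
qed

lemma forms_add: "f \<in> forms V t \<Longrightarrow> g \<in> forms V t \<Longrightarrow> f + g \<in> forms V t"
  using keys_add[of f g] by (auto simp: forms_iff)

lemma forms_mpoly_scale: "f \<in> forms V t \<Longrightarrow> mpoly_scale c f \<in> forms V t"
  using keys_mpoly_scale[of c f] by (auto simp: forms_iff)

lemma forms_sum: "(\<And>i. i \<in> S \<Longrightarrow> f i \<in> forms V t) \<Longrightarrow> sum f S \<in> forms V t"
  by (induction S rule: infinite_finite_induct) (auto simp: forms_add, auto simp: forms_def)

lemma forms_mult:
  assumes "f \<in> forms V s" "g \<in> forms V t"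
  shows "f * g \<in> forms V (s + t)"
proof -
  have "m \<in> monomials V (s + t)" if "m \<in> Poly_Mapping.keys (f * g)" for m
  proof -
    obtain a b where "m = a + b" "a \<in> Poly_Mapping.keys f" "b \<in> Poly_Mapping.keys g"
      using keys_mult[of f g] \<open>m \<in> _\<close> by blast
    then show ?thesis
      using assms by (auto simp: forms_iff monomials_def mono_degree_add keys_add_nat subset_iff)
  qed
  then show ?thesis by (auto simp: forms_iff)
qed

lemma mpoly_eval_form_scale:
  assumes "f \<in> forms V t"
  shows "mpoly_eval f (\<lambda>v. c * x v) = c ^ t * mpoly_eval f x"
proof -
  have "mono_degree m = t" if "m \<in> Poly_Mapping.keys f" for m
    using assms that by (auto simp: forms_def)
  then show ?thesis
    by (subst (1 2) mpoly_eval_superset[OF finite_keys order_refl])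
      (simp add: mono_eval_scale sum_distrib_left mult_ac)
qed

lemma vanishes_at_proj_point:
  assumes "f \<in> forms V t"
  shows "vanishes_at f (proj_point x) \<longleftrightarrow> mpoly_eval f x = 0"
proof
  assume "vanishes_at f (proj_point x)"
  moreover have "x \<in> proj_point x" by (auto simp: proj_point_def intro!: exI[of _ 1])
  ultimately show "mpoly_eval f x = 0" by (simp add: vanishes_at_def)
qed (auto simp: vanishes_at_def proj_point_def mpoly_eval_form_scale[OF assms])

section \<open>Independent forms along chains of irreducible sets\<close>

lemma zariski_closed_subset: "zariski_closed V Z \<Longrightarrow> Z \<subseteq> proj_space V"
  by (auto simp: zariski_closed_def)

lemma zariski_closed_form_Int:
  assumes "zariski_closed V Z" "f \<in> forms V t"
  shows "zariski_closed V {P \<in> Z. vanishes_at f P}"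
proof -
  obtain F where "F \<subseteq> (\<Union>t. forms V t)" "Z = {P \<in> proj_space V. \<forall>f\<in>F. vanishes_at f P}"
    using assms(1) by (auto simp: zariski_closed_def)
  with assms(2) show ?thesis
    unfolding zariski_closed_def by (intro exI[of _ "insert f F"]) auto
qed

text \<open>
  The two forms cut an irreducible set into two closed pieces covering it, so one piece is everything:
  the vanishing ideal is prime with respect to forms.
\<close>

lemma irreducible_closed_prime:
  assumes "irreducible_closed V Z" "f \<in> forms V s" "g \<in> forms V t"
    and "\<forall>P\<in>Z. vanishes_at (f * g) P"
  shows "(\<forall>P\<in>Z. vanishes_at f P) \<or> (\<forall>P\<in>Z. vanishes_at g P)"
proof -
  let ?F = "{P \<in> Z. vanishes_at f P}" and ?G = "{P \<in> Z. vanishes_at g P}"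
  have "P \<in> ?F \<union> ?G" if P: "P \<in> Z" for P
  proof -
    obtain x where "P = proj_point x"
      using assms(1) P zariski_closed_subset by (fastforce simp: irreducible_closed_def proj_space_def)
    then show ?thesis
      using assms(4) that vanishes_at_proj_point[OF assms(2)] vanishes_at_proj_point[OF assms(3)]
        vanishes_at_proj_point[OF forms_mult[OF assms(2,3)]] by (auto simp: mpoly_eval_mult)
  qed
  then have eq: "Z = ?F \<union> ?G" by auto
  have irr: "Z = Z1 \<or> Z = Z2"
    if "zariski_closed V Z1" "zariski_closed V Z2" "Z = Z1 \<union> Z2" for Z1 Z2
    using assms(1) that unfolding irreducible_closed_def by iprover
  have Z: "zariski_closed V Z" using assms(1) by (simp add: irreducible_closed_def)
  have "Z = ?F \<or> Z = ?G"
    by (rule irr[OF zariski_closed_form_Int[OF Z assms(2)] zariski_closed_form_Int[OF Z assms(3)] eq])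
  then show ?thesis by blast
qed

text \<open>
  Linear independence in the degree \<open>t\<close> part of the homogeneous coordinate ring of \<open>Z\<close>, expressed
  without forming the quotient.
\<close>

definition independent_forms ::
    "'v set \<Rightarrow> ('v \<Rightarrow> 'k::field) set set \<Rightarrow> nat \<Rightarrow> nat \<Rightarrow> (nat \<Rightarrow> ('v, 'k) mpoly) \<Rightarrow> bool" where
  "independent_forms V Z t N g \<longleftrightarrow> (\<forall>j<N. g j \<in> forms V t) \<and>
     (\<forall>c. (\<forall>P\<in>Z. vanishes_at (\<Sum>j<N. mpoly_scale (c j) (g j)) P) \<longrightarrow> (\<forall>j<N. c j = 0))"

lemma independent_forms_mono:
  "independent_forms V Z t N g \<Longrightarrow> Z \<subseteq> W \<Longrightarrow> independent_forms V W t N g"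
  unfolding independent_forms_def by blast

lemma independent_forms_point:
  fixes V :: "'v set" and Z :: "('v \<Rightarrow> 'k::field) set set"
  assumes "P \<in> Z" "P \<in> proj_space V"
  shows "\<exists>g. independent_forms V Z t 1 g"
proof -
  obtain x v where x: "P = proj_point x" "x v \<noteq> 0" "v \<in> V"
    using assms(2) by (auto simp: proj_space_def)
  define f :: "('v, 'k) mpoly" where "f = Poly_Mapping.single (Poly_Mapping.single v t) 1"
  have f: "f \<in> forms V t"
    using x(3) by (auto simp: f_def forms_iff monomials_def mono_degree_def)
  have "mpoly_eval f x \<noteq> 0"
    using x(2) by (simp add: f_def mpoly_eval_single mono_eval_def)
  then have "independent_forms V Z t 1 (\<lambda>_. f)"
    using f assms(1) x(1) vanishes_at_proj_point[OF forms_mpoly_scale[OF f]]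
    by (auto simp: independent_forms_def mpoly_eval_mpoly_scale)
  then show ?thesis by blast
qed

text \<open>
  With \<open>S\<close> for homogeneous coordinate rings, \<open>f\<close> multiplies \<open>S(W)\<close> injectively into the kernel of
  \<open>S(W) \<rightarrow> S(Z)\<close>, so independent elements of \<open>S(Z)\<close> and of \<open>S(W)\<close> combine. Explicitly, restricting
  a relation to \<open>Z\<close> kills the multiples of \<open>f\<close>, so the coefficients of the forms \<open>g\<close> are zero; what
  remains is divisible by \<open>f\<close>, which may be cancelled on the irreducible set \<open>W\<close>.
\<close>

lemma independent_forms_append:
  assumes W: "irreducible_closed V W" and "Z \<subseteq> W"
    and f: "f \<in> forms V e" and fZ: "\<forall>P\<in>Z. vanishes_at f P" and fW: "\<not> (\<forall>P\<in>W. vanishes_at f P)"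
    and g: "independent_forms V Z (e + t) N g" and h: "independent_forms V W t M h"
  shows "\<exists>k. independent_forms V W (e + t) (N + M) k"
proof -
  define k where "k = (\<lambda>j. if j < N then g j else f * h (j - N))"
  have split: "(\<Sum>j<N + M. mpoly_scale (c j) (k j))
      = (\<Sum>j<N. mpoly_scale (c j) (g j)) + f * (\<Sum>j<M. mpoly_scale (c (N + j)) (h j))" for c
  proof -
    have "(\<Sum>j<N + M. mpoly_scale (c j) (k j))
        = (\<Sum>j<N. mpoly_scale (c j) (k j)) + (\<Sum>j<M. mpoly_scale (c (N + j)) (k (N + j)))"
      by (induction M) (simp_all add: add.assoc)
    also have "(\<Sum>j<N. mpoly_scale (c j) (k j)) = (\<Sum>j<N. mpoly_scale (c j) (g j))"
      by (simp add: k_def)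
    also have "(\<Sum>j<M. mpoly_scale (c (N + j)) (k (N + j))) = f * (\<Sum>j<M. mpoly_scale (c (N + j)) (h j))"
      by (simp add: k_def sum_distrib_left mpoly_scale_def mult_ac)
    finally show ?thesis .
  qed
  have gf: "(\<Sum>j<N. mpoly_scale (c j) (g j)) \<in> forms V (e + t)" for c
    using g by (intro forms_sum forms_mpoly_scale) (auto simp: independent_forms_def)
  have hf: "(\<Sum>j<M. mpoly_scale (c (N + j)) (h j)) \<in> forms V t" for c
    using h by (intro forms_sum forms_mpoly_scale) (auto simp: independent_forms_def)
  have pt: "\<exists>x. P = proj_point x" if "P \<in> W" for P
    using W that zariski_closed_subset by (fastforce simp: irreducible_closed_def proj_space_def)
  have "independent_forms V W (e + t) (N + M) k"
    unfolding independent_forms_def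
  proof (intro conjI allI impI)
    fix j assume "j < N + M"
    then show "k j \<in> forms V (e + t)"
      using g h forms_mult[OF f] by (auto simp: k_def independent_forms_def)
  next
    fix c j assume van: "\<forall>P\<in>W. vanishes_at (\<Sum>j<N + M. mpoly_scale (c j) (k j)) P" and j: "j < N + M"
    let ?G = "\<Sum>j<N. mpoly_scale (c j) (g j)" and ?H = "\<Sum>j<M. mpoly_scale (c (N + j)) (h j)"
    have ev: "mpoly_eval ?G x + mpoly_eval f x * mpoly_eval ?H x = 0" if "proj_point x \<in> W" for x
      using van that vanishes_at_proj_point[OF forms_add[OF gf forms_mult[OF f hf]]]
      by (auto simp: split mpoly_eval_add mpoly_eval_mult)
    have "vanishes_at ?G P" if "P \<in> Z" for P
    proof -
      obtain x where x: "P = proj_point x" using pt \<open>P \<in> Z\<close> \<open>Z \<subseteq> W\<close> by blast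
      then show ?thesis
        using ev[of x] that \<open>Z \<subseteq> W\<close> bspec[OF fZ that] vanishes_at_proj_point[OF f, of x]
          vanishes_at_proj_point[OF gf, of c x] by auto
    qed
    then have cg: "\<forall>j<N. c j = 0" using g unfolding independent_forms_def by blast
    then have G0: "?G = 0" by simp
    have "vanishes_at (f * ?H) P" if "P \<in> W" for P
    proof -
      obtain x where x: "P = proj_point x" using pt \<open>P \<in> W\<close> by blast
      then show ?thesis
        using ev[of x] that vanishes_at_proj_point[OF forms_mult[OF f hf], of c x] by (auto simp: G0 mpoly_eval_mult)
    qed
    then have "\<forall>P\<in>W. vanishes_at ?H P"
      using irreducible_closed_prime[OF W f hf] fW by blast
    then have "\<forall>j<M. c (N + j) = 0" 
      using h unfolding independent_forms_def by (elim conjE allE[of _ "\<lambda>j. c (N + j)"]) blast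
    then show "c j = 0"
      using cg j by (metis add_diff_inverse_nat nat_add_left_cancel_less)
  qed
  then show ?thesis by blast
qed

lemma ex_separating_form:
  assumes "zariski_closed V Z" "W \<subseteq> proj_space V" "Z \<subset> W"
  obtains f e where "f \<in> forms V e" "\<forall>P\<in>Z. vanishes_at f P" "\<not> (\<forall>P\<in>W. vanishes_at f P)"
proof -
  obtain F where F: "F \<subseteq> (\<Union>t. forms V t)" "Z = {P \<in> proj_space V. \<forall>f\<in>F. vanishes_at f P}"
    using assms(1) by (auto simp: zariski_closed_def)
  obtain P where P: "P \<in> W" "P \<notin> Z" using assms(3) by blast
  then obtain f where "f \<in> F" "\<not> vanishes_at f P" using assms(2) F(2) by blast
  with F P show ?thesis using that by blast
qed

text \<open>
  The Hilbert function of the \<open>i\<close>-th member of a chain grows at least like a polynomial of degree \<open>i\<close>.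
  Each step of the inner induction on \<open>s\<close> applies \<open>independent_forms_append\<close> once and is Pascal's rule
  for the binomial coefficients. The slope \<open>E\<close> increases by the degree \<open>e\<close> of the separating form so
  that lowering \<open>s\<close> by one leaves room to divide by that form.
\<close>

lemma irreducible_chain_independent_forms:
  assumes irr: "\<And>i. i \<le> k \<Longrightarrow> irreducible_closed V (Z i)"
    and strict: "\<And>i. i < k \<Longrightarrow> Z i \<subset> Z (Suc i)" and "i \<le> k"
  shows "\<exists>E\<ge>1. \<forall>s t. E * s \<le> t \<longrightarrow> (\<exists>g. independent_forms V (Z i) t ((s + i) choose i) g)"
  using \<open>i \<le> k\<close>
proof (induction i)
  case 0
  obtain P where "P \<in> Z 0" "P \<in> proj_space V"
    using irr[of 0] zariski_closed_subset by (fastforce simp: irreducible_closed_def)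
  from independent_forms_point[OF this] show ?case by (intro exI[of _ 1]) auto
next
  case (Suc i)
  let ?W = "Z (Suc i)"
  obtain E where E: "E \<ge> 1" "\<And>s t. E * s \<le> t \<Longrightarrow> \<exists>g. independent_forms V (Z i) t ((s + i) choose i) g"
    using Suc by auto
  have W: "irreducible_closed V ?W" and sub: "Z i \<subset> ?W" using irr strict Suc.prems by auto
  have "zariski_closed V (Z i)" using irr[of i] Suc.prems by (simp add: irreducible_closed_def)
  moreover have WP: "?W \<subseteq> proj_space V" using W zariski_closed_subset by (auto simp: irreducible_closed_def)
  ultimately obtain f e where f: "f \<in> forms V e" "\<forall>P\<in>Z i. vanishes_at f P" "\<not> (\<forall>P\<in>?W. vanishes_at f P)"
    using ex_separating_form sub by metis
  have "\<exists>g. independent_forms V ?W t ((s + Suc i) choose Suc i) g" if "(E + e) * s \<le> t" for s t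
    using that
  proof (induction s arbitrary: t)
    case 0
    obtain P where "P \<in> ?W" using W by (auto simp: irreducible_closed_def)
    with WP independent_forms_point[of P ?W V t] show ?case by auto
  next
    case (Suc s)
    \<comment> \<open>Pascal's rule: \<open>g\<close> from \<open>Z i\<close> in degree \<open>t\<close>, and \<open>h\<close> from \<open>Z (Suc i)\<close> in degree \<open>t - e\<close>.\<close>
    define t' where "t' = t - e"
    have t: "t = e + t'" "(E + e) * s \<le> t'" "E * Suc s \<le> t"
      using Suc.prems E(1) by (auto simp: t'_def algebra_simps)
    obtain g where g: "independent_forms V (Z i) (e + t') ((Suc s + i) choose i) g"
      using E(2)[OF t(3)] t(1) by auto
    obtain h where h: "independent_forms V ?W t' ((s + Suc i) choose Suc i) h"
      using Suc.IH[OF t(2)] by blast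
    have "\<exists>k. independent_forms V ?W (e + t') (((Suc s + i) choose i) + ((s + Suc i) choose Suc i)) k"
      by (rule independent_forms_append[OF W _ f g h]) (use sub in blast)
    then show ?case by (simp add: t(1))
  qed
  then show ?case using E(1) by (intro exI[of _ "E + e"]) auto
qed

section \<open>Forms restricted to the monomial variety\<close>

text \<open>
  A monomial in the coordinates indexed by \<open>A\<close> is pulled back along the monomial map to the monomial
  with this exponent vector, up to a power of the homogenizing variable.
\<close>

definition exponent :: "((nat ^ 'n) \<Rightarrow>\<^sub>0 nat) \<Rightarrow> nat ^ 'n" where
  "exponent m = (\<chi> i. \<Sum>a\<in>Poly_Mapping.keys m. Poly_Mapping.lookup m a * a $ i)"

lemma exponent_component:
  assumes "finite A" "Poly_Mapping.keys m \<subseteq> A"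
  shows "exponent m $ i = (\<Sum>a\<in>A. Poly_Mapping.lookup m a * a $ i)"
  unfolding exponent_def vec_lambda_beta using assms
  by (intro sum.mono_neutral_left) (auto simp: in_keys_iff)

lemma finite_monomials:
  fixes V :: "'v set"
  assumes "finite V"
  shows "finite (monomials V t)"
proof (rule inj_on_finite)
  show "inj_on (\<lambda>m. restrict (Poly_Mapping.lookup m) V) (monomials V t)"
  proof (rule inj_onI)
    fix m m' assume m: "m \<in> monomials V t" "m' \<in> monomials V t"
      and eq: "restrict (Poly_Mapping.lookup m) V = restrict (Poly_Mapping.lookup m') V"
    show "m = m'"
    proof (rule poly_mapping_eqI)
      fix v show "Poly_Mapping.lookup m v = Poly_Mapping.lookup m' v"
      proof (cases "v \<in> V")
        case True then show ?thesis using fun_cong[OF eq, of v] by simp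
      next
        case False
        then have "v \<notin> Poly_Mapping.keys m" "v \<notin> Poly_Mapping.keys m'"
          using m by (auto simp: monomials_def)
        then show ?thesis by (simp add: in_keys_iff)
      qed
    qed
  qed
  show "(\<lambda>m. restrict (Poly_Mapping.lookup m) V) ` monomials V t \<subseteq> Pi\<^sub>E V (\<lambda>_. {..t})"
  proof (clarsimp simp: monomials_def)
    fix m :: "'v \<Rightarrow>\<^sub>0 nat" and v assume "v \<in> V" "Poly_Mapping.keys m \<subseteq> V"
    then show "Poly_Mapping.lookup m v \<le> mono_degree m"
      using assms by (subst mono_degree_superset[of V]) (auto intro: member_le_sum)
  qed
  show "finite (Pi\<^sub>E V (\<lambda>_. {..t}))" using assms by (intro finite_PiE) auto
qed

lemma exponent_image:
  assumes "finite A"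
  shows "exponent ` monomials A t = sumset t A"
proof (intro equalityI subsetI)
  fix x assume "x \<in> exponent ` monomials A t"
  then obtain m where m: "Poly_Mapping.keys m \<subseteq> A" "mono_degree m = t" "x = exponent m"
    by (auto simp: monomials_def)
  define M where "M = (\<Sum>a\<in>A. replicate_mset (Poly_Mapping.lookup m a) a)"
  have c: "count M a = Poly_Mapping.lookup m a" for a
    using m(1) assms by (auto simp: M_def count_sum in_keys_iff)
  have sub: "set_mset M \<subseteq> A"
    using m(1) by (auto simp: c in_keys_iff simp flip: count_greater_zero_iff)
  have "size M = t"
    using size_eq_sum_count[OF assms sub] mono_degree_superset[OF assms m(1)] m(2) by (simp add: c)
  moreover have "sum_mset M = x"
    using m assms sub by (simp add: vec_eq_iff sum_mset_component exponent_component c)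
  ultimately show "x \<in> sumset t A"
    using sub by (auto simp: sumset_eq_multisets multisets_of_size_def)
next
  fix x assume "x \<in> sumset t A"
  then obtain M where M: "set_mset M \<subseteq> A" "size M = t" "x = sum_mset M"
    by (auto simp: sumset_eq_multisets multisets_of_size_def)
  define m where "m = Poly_Mapping.Abs_poly_mapping (count M)"
  have c: "Poly_Mapping.lookup m = count M"
    unfolding m_def by (rule lookup_Abs_poly_mapping) (simp add: count_greater_zero_iff flip: set_mset_def)
  have k: "Poly_Mapping.keys m \<subseteq> A" using M(1) by (auto simp: in_keys_iff c)
  have "mono_degree m = t"
    using size_eq_sum_count[OF assms M(1)] mono_degree_superset[OF assms k] M(2) by (simp add: c)
  moreover have "exponent m = x"
    using M(1) k assms by (simp add: M(3) vec_eq_iff sum_mset_component exponent_component c)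
  ultimately show "x \<in> exponent ` monomials A t" using k by (auto simp: monomials_def)
qed

lemma vec_total_le_max_total:
  assumes "finite A" "a \<in> A"
  shows "vec_total a \<le> max_total A"
proof -
  have "\<forall>a\<in>A. vec_total a \<le> max_total A"
    unfolding max_total_def
    by (rule LeastI[of "\<lambda>\<delta>. \<forall>a\<in>A. vec_total a \<le> \<delta>" "Max (vec_total ` A)"]) (use assms(1) in auto)
  with assms(2) show ?thesis by blast
qed

definition pullback_monomial :: "(nat ^ 'n) set \<Rightarrow> nat \<Rightarrow> ('n option \<Rightarrow> 'k::field) \<Rightarrow> nat ^ 'n \<Rightarrow> 'k" where
  "pullback_monomial A t x s =
     x None ^ (t * max_total A - vec_total s) * (\<Prod>i\<in>UNIV. x (Some i) ^ (s $ i))"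

lemma mono_eval_monomial_map:
  assumes "finite A" "m \<in> monomials A t"
  shows "mono_eval m (monomial_map A x) = pullback_monomial A t x (exponent m)"
proof -
  let ?l = "Poly_Mapping.lookup m"
  have k: "Poly_Mapping.keys m \<subseteq> A" and t: "(\<Sum>a\<in>A. ?l a) = t"
    using assms mono_degree_superset[OF assms(1)] by (auto simp: monomials_def)
  have "vec_total (exponent m) = (\<Sum>i\<in>UNIV. \<Sum>a\<in>A. ?l a * a $ i)"
    by (simp add: vec_total_def exponent_component[OF assms(1) k])
  also have "\<dots> = (\<Sum>a\<in>A. ?l a * vec_total a)"
    by (subst sum.swap) (simp add: vec_total_def sum_distrib_left)
  finally have "(\<Sum>a\<in>A. ?l a * (max_total A - vec_total a)) + vec_total (exponent m)
      = (\<Sum>a\<in>A. ?l a * (max_total A - vec_total a) + ?l a * vec_total a)"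
    by (simp add: sum.distrib)
  also have "\<dots> = (\<Sum>a\<in>A. ?l a * max_total A)"
    using vec_total_le_max_total[OF assms(1)] by (intro sum.cong) (auto simp flip: distrib_left)
  also have "\<dots> = t * max_total A" by (simp add: t flip: sum_distrib_right)
  finally have deg: "(\<Sum>a\<in>A. ?l a * (max_total A - vec_total a)) = t * max_total A - vec_total (exponent m)"
    by simp
  have "mono_eval m (monomial_map A x) =
      (\<Prod>a\<in>A. (x None ^ (max_total A - vec_total a) * (\<Prod>i\<in>UNIV. x (Some i) ^ (a $ i))) ^ ?l a)"
    by (subst mono_eval_superset[OF assms(1) k]) (auto simp: monomial_map_def intro!: prod.cong)
  also have "\<dots> = (\<Prod>a\<in>A. x None ^ (?l a * (max_total A - vec_total a)))
      * (\<Prod>a\<in>A. \<Prod>i\<in>UNIV. x (Some i) ^ (?l a * a $ i))"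
    by (simp add: power_mult_distrib prod.distrib prod_power_distrib mult.commute flip: power_mult)
  also have "(\<Prod>a\<in>A. \<Prod>i\<in>UNIV. x (Some i) ^ (?l a * a $ i)) = (\<Prod>i\<in>UNIV. x (Some i) ^ (exponent m $ i))"
    by (subst prod.swap) (simp add: exponent_component[OF assms(1) k] power_sum)
  also have "(\<Prod>a\<in>A. x None ^ (?l a * (max_total A - vec_total a)))
      = x None ^ (t * max_total A - vec_total (exponent m))"
    by (simp flip: power_sum deg)
  finally show ?thesis by (simp add: pullback_monomial_def)
qed

text \<open>
  The coefficient of the monomial \<open>s\<close> in the pullback of \<open>f\<close> along the monomial map.
\<close>

definition fibre_sum :: "(nat ^ 'n) set \<Rightarrow> nat \<Rightarrow> (nat ^ 'n, 'k::field) mpoly \<Rightarrow> nat ^ 'n \<Rightarrow> 'k" where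
  "fibre_sum A t f s = (\<Sum>m | m \<in> monomials A t \<and> exponent m = s. Poly_Mapping.lookup f m)"

lemma mpoly_eval_monomial_map:
  assumes "finite A" "f \<in> forms A t"
  shows "mpoly_eval f (monomial_map A x)
    = (\<Sum>s\<in>sumset t A. fibre_sum A t f s * pullback_monomial A t x s)"
proof -
  have "mpoly_eval f (monomial_map A x)
      = (\<Sum>m\<in>monomials A t. Poly_Mapping.lookup f m * mono_eval m (monomial_map A x))"
    using assms finite_monomials by (intro mpoly_eval_superset) (auto simp: forms_iff)
  also have "\<dots> = (\<Sum>m\<in>monomials A t. Poly_Mapping.lookup f m * pullback_monomial A t x (exponent m))"
    using assms by (intro sum.cong) (auto simp: mono_eval_monomial_map)
  also have "\<dots> = (\<Sum>s\<in>sumset t A. \<Sum>m | m \<in> monomials A t \<and> exponent m = s.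
      Poly_Mapping.lookup f m * pullback_monomial A t x (exponent m))"
    using assms by (intro sum.group[symmetric]) (auto simp: finite_monomials finite_sumset exponent_image)
  also have "\<dots> = (\<Sum>s\<in>sumset t A. fibre_sum A t f s * pullback_monomial A t x s)"
    by (intro sum.cong) (auto simp: fibre_sum_def sum_distrib_right)
  finally show ?thesis .
qed

text \<open>
  The Vandermonde argument. By linearity the sum still vanishes when the power is replaced by a
  polynomial, and a polynomial with roots at all nodes but one isolates a single coefficient.
\<close>

lemma coefficients_zero_if_power_sums_zero:
  fixes N g :: "'a \<Rightarrow> 'k::field"
  assumes "finite S" "inj_on N S" "\<And>k. (\<Sum>s\<in>S. g s * N s ^ k) = 0" "s \<in> S"
  shows "g s = 0"
proof -
  have all: "(\<Sum>s\<in>S. g s * poly q (N s)) = 0" for q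
  proof -
    have "(\<Sum>s\<in>S. g s * poly q (N s)) = (\<Sum>s\<in>S. \<Sum>i\<le>Polynomial.degree q. Polynomial.coeff q i * (g s * N s ^ i))"
      by (simp add: poly_altdef sum_distrib_left mult_ac)
    also have "\<dots> = (\<Sum>i\<le>Polynomial.degree q. Polynomial.coeff q i * (\<Sum>s\<in>S. g s * N s ^ i))"
      by (subst sum.swap) (simp add: sum_distrib_left)
    finally show ?thesis by (simp add: assms(3))
  qed
  define q where "q = (\<Prod>s'\<in>S - {s}. [:- N s', 1:])"
  have "poly q (N s') = 0" if "s' \<in> S - {s}" for s'
    using that assms(1) by (auto simp: q_def poly_prod intro!: prod_zero)
  then have "g s * poly q (N s) = 0"
    using all[of q] assms(1,4) by (simp add: sum.remove[of S s])
  moreover have "poly q (N s) \<noteq> 0"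
    using assms(1,2,4) by (auto simp: q_def poly_prod inj_on_def)
  ultimately show ?thesis by simp
qed

lemma ex_inj_primes: "\<exists>p :: 'n::finite \<Rightarrow> nat. inj p \<and> (\<forall>i. prime (p i))"
proof -
  obtain B where B: "B \<subseteq> {p::nat. prime p}" "finite B" "card B = CARD('n)"
    using infinite_arbitrarily_large[OF primes_infinite] by blast
  then obtain p where "bij_betw p (UNIV :: 'n set) B"
    using finite_same_card_bij[of "UNIV :: 'n set" B] by auto
  with B show ?thesis by (auto simp: bij_betw_def intro!: exI[of _ p])
qed

text \<open>
  Evaluating all monomials at a point whose coordinates are distinct primes separates them, by unique
  factorization. Together with the Vandermonde argument, applied to the powers of this one point, it
  proves that distinct monomials are linearly independent on the torus.
\<close>

lemma inj_prime_powers: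
  fixes p :: "'n::finite \<Rightarrow> nat"
  assumes "inj p" "\<And>i. prime (p i)"
  shows "inj (\<lambda>s :: nat ^ 'n. \<Prod>i\<in>UNIV. p i ^ (s $ i))"
proof (rule injI)
  fix s s' :: "nat ^ 'n" assume eq: "(\<Prod>i\<in>UNIV. p i ^ (s $ i)) = (\<Prod>i\<in>UNIV. p i ^ (s' $ i))"
  have "multiplicity (p j) (\<Prod>i\<in>UNIV. p i ^ (s $ i)) = s $ j" for s :: "nat ^ 'n" and j
  proof -
    have "(\<Prod>i\<in>UNIV. p i ^ (s $ i)) = (\<Prod>q\<in>range p. q ^ (s $ inv p q))"
      by (subst prod.reindex) (auto simp: assms inv_f_f)
    also have "multiplicity (p j) \<dots> = (if p j \<in> range p then s $ inv p (p j) else 0)"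
      by (rule multiplicity_prod_prime_powers) (use assms in auto)
    finally show ?thesis using assms(1) by (simp add: inv_f_f)
  qed
  note mult = this
  have "s $ j = s' $ j" for j
    using mult[of j s] unfolding eq mult[of j s'] by (rule sym)
  then show "s = s'" by (simp add: vec_eq_iff)
qed

text \<open>
  The forms vanishing on the variety are the kernel of the pullback. One direction evaluates at the
  powers of a point with prime coordinates; for the other one, the zero set of \<open>f\<close> is closed and
  contains the image of the monomial map, hence its closure.
\<close>

lemma vanishing_forms_monomial_variety:
  fixes A :: "(nat ^ 'n) set" and f :: "(nat ^ 'n, 'k::field_char_0) mpoly"
  assumes "finite A" "A \<noteq> {}" and f: "f \<in> forms A t"
  shows "(\<forall>P\<in>monomial_variety A. vanishes_at f P) \<longleftrightarrow> (\<forall>s\<in>sumset t A. fibre_sum A t f s = 0)"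
proof
  let ?I = "{proj_point (monomial_map A x) | x. (\<exists>j. x j \<noteq> 0) \<and> (\<exists>a. monomial_map A x a \<noteq> (0::'k))}"
  assume van: "\<forall>P\<in>monomial_variety A. vanishes_at f P"
  have sub: "?I \<subseteq> monomial_variety A"
    unfolding monomial_variety_def zariski_closure_def by (rule hull_subset)
  obtain p :: "'n \<Rightarrow> nat" where p: "inj p" "\<And>i. prime (p i)" using ex_inj_primes by blast
  define N :: "nat ^ 'n \<Rightarrow> 'k" where "N = (\<lambda>s. of_nat (\<Prod>i\<in>UNIV. p i ^ (s $ i)))"
  have injN: "inj_on N (sumset t A)"
    using inj_prime_powers[OF p] by (auto simp: N_def inj_on_def inj_def simp del: of_nat_prod)
  have "(\<Sum>s\<in>sumset t A. fibre_sum A t f s * N s ^ k) = 0" for k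
  proof -
    \<comment> \<open>The homogenizing variable is set to 1, so its exponent disappears.\<close>
    define x :: "'n option \<Rightarrow> 'k" where "x = (\<lambda>j. case j of None \<Rightarrow> 1 | Some i \<Rightarrow> of_nat (p i) ^ k)"
    have nz: "x j \<noteq> 0" for j
      using p(2) by (auto simp: x_def split: option.splits dest: prime_gt_0_nat)
    obtain a where "a \<in> A" using assms(2) by blast
    then have "monomial_map A x a \<noteq> 0" by (simp add: monomial_map_def nz)
    with nz have "proj_point (monomial_map A x) \<in> ?I" by blast
    then have "mpoly_eval f (monomial_map A x) = 0"
      using van sub vanishes_at_proj_point[OF f] by blast
    moreover have "pullback_monomial A t x s = N s ^ k" for s
      by (simp add: pullback_monomial_def x_def N_def mult.commute prod_power_distrib flip: power_mult)
    ultimately show ?thesis by (simp add: mpoly_eval_monomial_map[OF assms(1) f])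
  qed
  from coefficients_zero_if_power_sums_zero[OF finite_sumset[OF assms(1)] injN this]
  show "\<forall>s\<in>sumset t A. fibre_sum A t f s = 0" by blast
next
  let ?I = "{proj_point (monomial_map A x) | x. (\<exists>j. x j \<noteq> 0) \<and> (\<exists>a. monomial_map A x a \<noteq> (0::'k))}"
  assume zero: "\<forall>s\<in>sumset t A. fibre_sum A t f s = 0"
  let ?Z = "{P \<in> proj_space A. vanishes_at f P}"
  have "zariski_closed A ?Z"
    unfolding zariski_closed_def using f by (intro exI[of _ "{f}"]) auto
  moreover have "?I \<subseteq> ?Z"
  proof
    fix P assume "P \<in> ?I"
    then obtain x :: "'n option \<Rightarrow> 'k" and a where P: "P = proj_point (monomial_map A x)"
      and "monomial_map A x a \<noteq> 0" by blast
    moreover have "monomial_map A x v = 0" if "v \<notin> A" for v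
      using that by (simp add: monomial_map_def)
    ultimately have "proj_point (monomial_map A x) \<in> proj_space A"
      unfolding proj_space_def by blast
    moreover have "vanishes_at f (proj_point (monomial_map A x))"
      by (simp add: vanishes_at_proj_point[OF f] mpoly_eval_monomial_map[OF assms(1) f] zero)
    ultimately show "P \<in> ?Z" by (simp add: P)
  qed
  ultimately have "monomial_variety A \<subseteq> ?Z"
    unfolding monomial_variety_def zariski_closure_def by (intro hull_minimal)
  then show "\<forall>P\<in>monomial_variety A. vanishes_at f P" by blast
qed

section \<open>Hilbert function and dimension of the monomial variety\<close>

lemma independent_family:
  fixes h :: "'i \<Rightarrow> ('v, 'k::field) mpoly"
  assumes "finite I"
    and zero: "\<And>c. (\<Sum>i\<in>I. mpoly_scale (c i) (h i)) = 0 \<Longrightarrow> \<forall>i\<in>I. c i = 0"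
  shows "inj_on h I" and "\<not> mpoly_vs.dependent (h ` I)"
proof -
  show inj: "inj_on h I"
  proof (rule inj_onI, rule ccontr)
    fix i j assume ij: "i \<in> I" "j \<in> I" "h i = h j" "i \<noteq> j"
    define c :: "'i \<Rightarrow> 'k" where "c = (\<lambda>k. if k = i then 1 else if k = j then - 1 else 0)"
    have "(\<Sum>k\<in>I. mpoly_scale (c k) (h k)) = (\<Sum>k\<in>{i, j}. mpoly_scale (c k) (h k))"
      using assms(1) ij by (intro sum.mono_neutral_right) (auto simp: c_def)
    also have "\<dots> = 0" using ij by (simp add: c_def)
    finally have "c i = 0" using zero[of c] ij(1) by simp
    then show False by (simp add: c_def)
  qed
  show "\<not> mpoly_vs.dependent (h ` I)"
  proof (rule mpoly_vs.independent_if_scalars_zero)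
    fix f x assume f: "(\<Sum>x\<in>h ` I. mpoly_scale (f x) x) = 0" and x: "x \<in> h ` I"
    have "(\<Sum>i\<in>I. mpoly_scale (f (h i)) (h i)) = 0" using f by (simp add: sum.reindex[OF inj])
    from zero[OF this] x show "f x = 0" by auto
  qed (use assms(1) in simp)
qed

definition representative :: "(nat ^ 'n) set \<Rightarrow> nat \<Rightarrow> nat ^ 'n \<Rightarrow> (nat ^ 'n) \<Rightarrow>\<^sub>0 nat" where
  "representative A t s = (SOME m. m \<in> monomials A t \<and> exponent m = s)"

lemma representative:
  assumes "finite A" "s \<in> sumset t A"
  shows "representative A t s \<in> monomials A t" "exponent (representative A t s) = s"
proof -
  have "\<exists>m. m \<in> monomials A t \<and> exponent m = s"
    using assms(2) unfolding exponent_image[OF assms(1), symmetric] by auto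
  from someI_ex[OF this] show "representative A t s \<in> monomials A t" "exponent (representative A t s) = s"
    unfolding representative_def by simp_all
qed

lemma inj_on_representative: "finite A \<Longrightarrow> inj_on (representative A t) (sumset t A)"
  by (rule inj_on_inverseI[of _ exponent]) (rule representative(2))

lemma fibre_sum_lincomb:
  "fibre_sum A t (\<Sum>i\<in>I. mpoly_scale (c i) (f i)) s = (\<Sum>i\<in>I. c i * fibre_sum A t (f i) s)"
proof -
  have "fibre_sum A t (\<Sum>i\<in>I. mpoly_scale (c i) (f i)) s
      = (\<Sum>m | m \<in> monomials A t \<and> exponent m = s. \<Sum>i\<in>I. c i * Poly_Mapping.lookup (f i) m)"
    by (simp add: fibre_sum_def lookup_sum)
  also have "\<dots> = (\<Sum>i\<in>I. c i * fibre_sum A t (f i) s)"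
    by (subst sum.swap) (simp add: fibre_sum_def sum_distrib_left)
  finally show ?thesis .
qed

text \<open>
  A linear map sends a form to its vector of fibre sums, realized inside the space of forms on the
  representatives. Its kernel consists of the forms vanishing on the variety, so it preserves
  independence, and its image is spanned by \<open>|tA|\<close> elements.
\<close>

lemma card_independent_forms_le:
  fixes A :: "(nat ^ 'n) set" and g :: "nat \<Rightarrow> (nat ^ 'n, 'k::field_char_0) mpoly"
  assumes "finite A" "A \<noteq> {}" and g: "independent_forms A (monomial_variety A) t N g"
  shows "N \<le> card (sumset t A)"
proof -
  define b :: "nat ^ 'n \<Rightarrow> (nat ^ 'n, 'k) mpoly" where "b = (\<lambda>s. Poly_Mapping.single (representative A t s) 1)"
  define h where "h = (\<lambda>j. \<Sum>s\<in>sumset t A. mpoly_scale (fibre_sum A t (g j) s) (b s))"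
  have fin: "finite (sumset t A)" using assms(1) by (rule finite_sumset)
  have coeff: "Poly_Mapping.lookup (h j) (representative A t s) = fibre_sum A t (g j) s"
    if s: "s \<in> sumset t A" for j s
  proof -
    have "Poly_Mapping.lookup (h j) (representative A t s)
        = (\<Sum>s'\<in>sumset t A. if s' = s then fibre_sum A t (g j) s' else 0)"
      unfolding h_def lookup_sum
      using inj_onD[OF inj_on_representative[OF assms(1)]] s
      by (intro sum.cong) (auto simp: b_def lookup_single when_def)
    with fin s show ?thesis by simp
  qed
  have zero: "\<forall>j\<in>{..<N}. c j = 0" if c: "(\<Sum>j<N. mpoly_scale (c j) (h j)) = 0" for c
  proof -
    let ?f = "\<Sum>j<N. mpoly_scale (c j) (g j)"
    have f: "?f \<in> forms A t"
      using g by (intro forms_sum forms_mpoly_scale) (auto simp: independent_forms_def)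
    have "fibre_sum A t ?f s = 0" if s: "s \<in> sumset t A" for s
    proof -
      have "fibre_sum A t ?f s = Poly_Mapping.lookup (\<Sum>j<N. mpoly_scale (c j) (h j)) (representative A t s)"
        by (simp add: fibre_sum_lincomb lookup_sum coeff[OF s])
      then show ?thesis by (simp add: c)
    qed
    then have "\<forall>P\<in>monomial_variety A. vanishes_at ?f P"
      using vanishing_forms_monomial_variety[OF assms(1,2) f] by blast
    then show ?thesis using g unfolding independent_forms_def by blast
  qed
  note ind = independent_family[of "{..<N}" h, OF _ zero]
  have "h ` {..<N} \<subseteq> mpoly_vs.span (b ` sumset t A)"
    unfolding h_def
    by (intro image_subsetI mpoly_vs.span_sum mpoly_vs.span_scale mpoly_vs.span_base) auto
  then have "card (h ` {..<N}) \<le> card (b ` sumset t A)"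
    using mpoly_vs.independent_span_bound[OF _ ind(2)] fin by simp
  also have "\<dots> \<le> card (sumset t A)" using fin by (rule card_image_le)
  finally show ?thesis using ind(1) by (simp add: card_image)
qed

lemma dim_forms:
  assumes "finite V"
  shows "mpoly_vs.dim (forms V t :: ('v, 'k::field) mpoly set) = card (monomials V t)"
proof -
  define b :: "('v \<Rightarrow>\<^sub>0 nat) \<Rightarrow> ('v, 'k) mpoly" where "b = (\<lambda>m. Poly_Mapping.single m 1)"
  have fin: "finite (monomials V t)" using assms by (rule finite_monomials)
  have lookup_b: "Poly_Mapping.lookup (\<Sum>m\<in>S. mpoly_scale (c m) (b m)) m' = (if m' \<in> S then c m' else 0)"
    if "finite S" for S c m'
    using that
    by (simp add: lookup_sum b_def lookup_single when_def if_distrib[of "(*) _"] cong: if_cong)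
  have ind: "\<forall>m\<in>monomials V t. c m = 0" if "(\<Sum>m\<in>monomials V t. mpoly_scale (c m) (b m)) = 0" for c
  proof
    fix m assume "m \<in> monomials V t"
    then show "c m = 0" using lookup_b[OF fin, of c m] that by simp
  qed
  note fam = independent_family[OF fin ind]
  show ?thesis
  proof (rule mpoly_vs.dim_unique)
    show "b ` monomials V t \<subseteq> forms V t" by (auto simp: b_def forms_iff)
    show "forms V t \<subseteq> mpoly_vs.span (b ` monomials V t)"
    proof
      fix f :: "('v, 'k) mpoly" assume f: "f \<in> forms V t"
      then have "f = (\<Sum>m\<in>monomials V t. mpoly_scale (Poly_Mapping.lookup f m) (b m))"
        by (intro poly_mapping_eqI) (auto simp: lookup_b[OF fin] forms_iff in_keys_iff)
      also have "\<dots> \<in> mpoly_vs.span (b ` monomials V t)"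
        by (intro mpoly_vs.span_sum mpoly_vs.span_scale mpoly_vs.span_base) auto
      finally show "f \<in> mpoly_vs.span (b ` monomials V t)" .
    qed
    show "\<not> mpoly_vs.dependent (b ` monomials V t)" by (rule fam(2))
    show "card (b ` monomials V t) = card (monomials V t)" by (rule card_image[OF fam(1)])
  qed
qed

text \<open>
  The binomials \<open>m - rep m\<close>, with \<open>m\<close> not a chosen representative of its fibre, form a basis: the
  fibre sums of a vanishing form are zero, so \<open>f = (\<Sum>m. f\<^sub>m (m - rep m))\<close>.
\<close>

lemma dim_vanishing_forms:
  fixes A :: "(nat ^ 'n) set"
  assumes "finite A" "A \<noteq> {}"
  shows "mpoly_vs.dim (vanishing_forms A (monomial_variety A :: (nat ^ 'n \<Rightarrow> 'k::field_char_0) set set) t)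
    = card (monomials A t) - card (sumset t A)"
proof -
  \<comment> \<open>One monomial per fibre is kept fixed; the others are compared with it.\<close>
  define R where "R = representative A t ` sumset t A"
  define rep where "rep = (\<lambda>m. representative A t (exponent m))"
  define b :: "((nat ^ 'n) \<Rightarrow>\<^sub>0 nat) \<Rightarrow> (nat ^ 'n, 'k) mpoly"
    where "b = (\<lambda>m. Poly_Mapping.single m 1 - Poly_Mapping.single (rep m) 1)"
  let ?I = "monomials A t - R"
  let ?V = "vanishing_forms A (monomial_variety A :: (nat ^ 'n \<Rightarrow> 'k) set set) t"
  have finM: "finite (monomials A t)" using assms(1) by (rule finite_monomials)
  then have fin: "finite ?I" by simp
  have R: "R \<subseteq> monomials A t" using representative(1)[OF assms(1)] by (auto simp: R_def)
  have expo: "exponent m \<in> sumset t A" if "m \<in> monomials A t" for m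
    using that unfolding exponent_image[OF assms(1), symmetric] by (rule imageI)
  have rep: "rep m \<in> R" "exponent (rep m) = exponent m" if "m \<in> monomials A t" for m
    using representative(2)[OF assms(1) expo[OF that]] expo[OF that] by (auto simp: rep_def R_def)
  have rep_R: "rep m = m" if "m \<in> R" for m
    using that representative(2)[OF assms(1)] by (auto simp: R_def rep_def)
  have V: "f \<in> ?V \<longleftrightarrow> f \<in> forms A t \<and> (\<forall>s\<in>sumset t A. fibre_sum A t f s = 0)" for f :: "(nat ^ 'n, 'k) mpoly"
    using vanishing_forms_monomial_variety[OF assms] by (auto simp: vanishing_forms_def)
  have ind: "\<forall>m\<in>?I. c m = 0" if c: "(\<Sum>m\<in>?I. mpoly_scale (c m) (b m)) = 0" for c
  proof
    fix m assume m: "m \<in> ?I"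
    have "Poly_Mapping.lookup (\<Sum>m\<in>?I. mpoly_scale (c m) (b m)) m = (\<Sum>m'\<in>?I. if m' = m then c m' else 0)"
      unfolding lookup_sum
    proof (rule sum.cong)
      fix m' assume "m' \<in> ?I"
      then have "rep m' \<noteq> m" using rep(1)[of m'] m by auto
      then show "Poly_Mapping.lookup (mpoly_scale (c m') (b m')) m = (if m' = m then c m' else 0)"
        by (simp add: b_def lookup_minus lookup_single when_def)
    qed simp
    then show "c m = 0" using c m fin by simp
  qed
  note fam = independent_family[OF fin ind]
  have "mpoly_vs.dim ?V = card ?I"
  proof (rule mpoly_vs.dim_unique)
    show "b ` ?I \<subseteq> ?V"
    proof clarify
      fix m assume m: "m \<in> monomials A t" "m \<notin> R"
      have rm: "rep m \<in> monomials A t" using rep(1) R m by blast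
      have "Poly_Mapping.keys (b m) \<subseteq> {m, rep m}"
        by (auto simp: b_def in_keys_iff lookup_minus lookup_single when_def split: if_splits)
      then have f: "b m \<in> forms A t" using m rm by (auto simp: forms_iff)
      have "fibre_sum A t (b m) s = 0" for s
      proof -
        let ?F = "{m'. m' \<in> monomials A t \<and> exponent m' = s}"
        have "finite ?F" using finM by simp
        moreover have "m \<in> ?F \<longleftrightarrow> rep m \<in> ?F" using m rm rep(2) by auto
        ultimately show ?thesis
          by (simp add: fibre_sum_def b_def lookup_minus sum_subtractf lookup_single when_def)
      qed
      with f show "b m \<in> ?V" by (simp add: V)
    qed
    show "?V \<subseteq> mpoly_vs.span (b ` ?I)"
    proof
      fix f :: "(nat ^ 'n, 'k) mpoly" assume "f \<in> ?V"
      then have f: "Poly_Mapping.keys f \<subseteq> monomials A t" and z: "\<And>s. s \<in> sumset t A \<Longrightarrow> fibre_sum A t f s = 0"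
        by (auto simp: V forms_iff)
      have "(\<Sum>m\<in>monomials A t. Poly_Mapping.single (rep m) (Poly_Mapping.lookup f m))
          = (\<Sum>s\<in>sumset t A. \<Sum>m | m \<in> monomials A t \<and> exponent m = s. Poly_Mapping.single (rep m) (Poly_Mapping.lookup f m))"
        using finM assms(1) by (intro sum.group[symmetric]) (auto simp: finite_sumset exponent_image)
      also have "\<dots> = (\<Sum>s\<in>sumset t A. Poly_Mapping.single (representative A t s) (fibre_sum A t f s))"
      proof (rule sum.cong)
        fix s
        have "(\<Sum>m\<in>F. Poly_Mapping.single r (Poly_Mapping.lookup f m)) = Poly_Mapping.single r (\<Sum>m\<in>F. Poly_Mapping.lookup f m)"
          if "finite F" for F and r :: "(nat ^ 'n) \<Rightarrow>\<^sub>0 nat"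
          using that by (induction F) (auto simp: single_add)
        then show "(\<Sum>m | m \<in> monomials A t \<and> exponent m = s. Poly_Mapping.single (rep m) (Poly_Mapping.lookup f m))
          = Poly_Mapping.single (representative A t s) (fibre_sum A t f s)"
          using finM by (simp add: rep_def fibre_sum_def)
      qed simp
      also have "\<dots> = 0" by (simp add: z)
      finally have rz: "(\<Sum>m\<in>monomials A t. Poly_Mapping.single (rep m) (Poly_Mapping.lookup f m)) = 0" .
      have "f = (\<Sum>m\<in>monomials A t. Poly_Mapping.single m (Poly_Mapping.lookup f m))"
        by (rule mpoly_eq_sum_singles[OF finM f])
      also have "\<dots> = (\<Sum>m\<in>monomials A t. Poly_Mapping.single m (Poly_Mapping.lookup f m)
          - Poly_Mapping.single (rep m) (Poly_Mapping.lookup f m))"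
        by (simp add: sum_subtractf rz)
      also have "\<dots> = (\<Sum>m\<in>?I. Poly_Mapping.single m (Poly_Mapping.lookup f m)
          - Poly_Mapping.single (rep m) (Poly_Mapping.lookup f m))"
        using finM rep_R by (intro sum.mono_neutral_right) auto
      also have "\<dots> = (\<Sum>m\<in>?I. mpoly_scale (Poly_Mapping.lookup f m) (b m))"
        by (intro sum.cong) (auto intro!: poly_mapping_eqI simp: b_def lookup_minus lookup_single when_def)
      also have "\<dots> \<in> mpoly_vs.span (b ` ?I)"
        by (intro mpoly_vs.span_sum mpoly_vs.span_scale mpoly_vs.span_base) auto
      finally show "f \<in> mpoly_vs.span (b ` ?I)" .
    qed
    show "\<not> mpoly_vs.dependent (b ` ?I)" by (rule fam(2))
    show "card (b ` ?I) = card ?I" by (rule card_image[OF fam(1)])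
  qed
  also have "\<dots> = card (monomials A t) - card R"
    by (rule card_Diff_subset) (use R finM finite_subset in auto)
  also have "card R = card (sumset t A)"
    unfolding R_def by (rule card_image[OF inj_on_representative[OF assms(1)]])
  finally show ?thesis .
qed

theorem hilbert_function_monomial_variety:
  fixes A :: "(nat ^ 'n) set"
  assumes "finite A" "A \<noteq> {}"
  shows "hilbert_function A (monomial_variety A :: (nat ^ 'n \<Rightarrow> 'k::field_char_0) set set) t = card (sumset t A)"
proof -
  have "card (sumset t A) \<le> card (monomials A t)"
    using card_image_le[OF finite_monomials[OF assms(1), of t], of exponent]
    by (simp add: exponent_image[OF assms(1)])
  then show ?thesis
    by (simp add: hilbert_function_def dim_forms[OF assms(1)] dim_vanishing_forms[OF assms])
qed

text \<open>
  A supremum of extended naturals that is finite and positive is attained, which supplies a chain of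
  length \<open>n\<close>. If \<open>A\<close> were contained in a hyperplane, the lower bound of degree \<open>n\<close> from the chain
  would contradict the upper bound of degree \<open>n - 1\<close> for \<open>|tA|\<close>.
\<close>

theorem aff_dim_eq_if_proj_dim_eq:
  fixes A :: "(nat ^ 'n) set"
  assumes "finite A" "A \<noteq> {}"
    and dim: "proj_dim A (monomial_variety A :: (nat ^ 'n \<Rightarrow> 'k::field_char_0) set set) = enat CARD('n)"
  shows "aff_dim (real_vec ` A) = CARD('n)"
proof (rule ccontr)
  assume "aff_dim (real_vec ` A) \<noteq> CARD('n)"
  then have "aff_dim (real_vec ` A) < int DIM(real ^ 'n)"
    using aff_dim_le_DIM[of "real_vec ` A"] by simp
  then obtain h b where h: "h \<noteq> 0" "real_vec ` A \<subseteq> {x. h \<bullet> x = b}"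
    by (rule aff_lowdim_subset_hyperplane)
  let ?n = "CARD('n)" and ?Y = "monomial_variety A :: (nat ^ 'n \<Rightarrow> 'k) set set"
  define K where "K = {enat k | k. \<exists>Z. (\<forall>i\<le>k. irreducible_closed A (Z i) \<and> Z i \<subseteq> ?Y)
    \<and> (\<forall>i<k. Z i \<subset> Z (Suc i))}"
  have n: "?n > 0" by simp
  have "Sup K = enat ?n" using dim by (simp add: proj_dim_def K_def)
  \<comment> \<open>An infinite \<open>K\<close> has supremum \<open>\<infinity>\<close>, an empty one supremum \<open>0 < n\<close>.\<close>
  then have "K \<noteq> {} \<and> finite K \<and> Max K = enat ?n"
    using n by (auto simp: Sup_enat_def enat_0_iff split: if_splits)
  then have "enat ?n \<in> K"
    using Max_in[of K] by simp
  then obtain Z where Z: "\<And>i. i \<le> ?n \<Longrightarrow> irreducible_closed A (Z i)" "\<And>i. i \<le> ?n \<Longrightarrow> Z i \<subseteq> ?Y"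
    "\<And>i. i < ?n \<Longrightarrow> Z i \<subset> Z (Suc i)"
    by (auto simp: K_def)
  obtain E where E: "\<And>s t. E * s \<le> t \<Longrightarrow> \<exists>g. independent_forms A (Z ?n) t ((s + ?n) choose ?n) g"
    using irreducible_chain_independent_forms[of ?n A Z ?n] Z by blast
  define M where "M = Max (insert 0 (\<Union>a\<in>A. range (vec_nth a)))"
  have M: "a $ i \<le> M" if "a \<in> A" for a i
    unfolding M_def by (rule Max_ge) (use assms(1) that in auto)
  obtain s where s: "(s * (E * M) + 1) ^ (?n - 1) < (s + ((?n - 1) + 1)) choose ((?n - 1) + 1)"
    using power_less_binomial by blast
  obtain g where "independent_forms A (Z ?n) (E * s) ((s + ?n) choose ?n) g"
    using E[of s "E * s"] by auto
  then have "(s + ?n) choose ?n \<le> card (sumset (E * s) A)"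
    using card_independent_forms_le[OF assms(1,2)] independent_forms_mono Z(2) by blast
  also have "\<dots> \<le> (E * s * M + 1) ^ (?n - 1)"
    by (rule card_sumset_le_hyperplane[OF assms(1) M h(1), where b = b]) (use h(2) in auto)
  finally have "(s + ?n) choose ?n \<le> (E * s * M + 1) ^ (?n - 1)" .
  moreover have "?n - 1 + 1 = ?n" "s * (E * M) = E * s * M" using n by simp_all
  ultimately show False using s by (simp only: not_le)
qed

section \<open>The polynomials in the counting formulas\<close>

definition gbinomial_poly :: "nat \<Rightarrow> rat \<Rightarrow> rat poly" where
  "gbinomial_poly k c = Polynomial.smult (1 / fact k) (\<Prod>i<k. [:c - of_nat i, 1:])"

lemma poly_gbinomial_poly: "poly (gbinomial_poly k c) x = (x + c) gchoose k"
  by (simp add: gbinomial_poly_def poly_prod gbinomial_prod_rev lessThan_atLeast0 algebra_simps)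

lemma degree_gbinomial_poly: "Polynomial.degree (gbinomial_poly k c) = k"
  and lead_coeff_gbinomial_poly: "lead_coeff (gbinomial_poly k c) = 1 / fact k"
proof -
  let ?q = "\<Prod>i<k. [:c - of_nat i, 1:]"
  show "Polynomial.degree (gbinomial_poly k c) = k"
    by (simp add: gbinomial_poly_def degree_prod_sum_eq)
  have "lead_coeff ?q = 1" by (simp add: lead_coeff_prod)
  then show "lead_coeff (gbinomial_poly k c) = 1 / fact k"
    unfolding gbinomial_poly_def lead_coeff_smult by simp
qed

text \<open>
  The difference of two binomial coefficients with lower entry \<open>n + 1\<close> and upper entries \<open>d\<close> apart,
  telescoped by Pascal's rule. In this form each of the \<open>d\<close> summands has degree \<open>n\<close> and leading
  coefficient \<open>1 / n!\<close>, so nothing cancels.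
\<close>

definition difference_poly :: "nat \<Rightarrow> nat \<Rightarrow> rat poly" where
  "difference_poly n d = (\<Sum>j<d. gbinomial_poly n (of_nat n - of_nat j))"

lemma poly_difference_poly:
  "poly (difference_poly n d) x
    = ((x + of_nat n + 1) gchoose (n + 1)) - ((x + of_nat n + 1 - of_nat d) gchoose (n + 1))"
proof (induction d)
  case 0
  then show ?case by (simp add: difference_poly_def)
next
  case (Suc d)
  have "((x + of_nat n - of_nat d) + 1) gchoose (Suc n)
      = ((x + of_nat n - of_nat d) gchoose n) + ((x + of_nat n - of_nat d) gchoose (Suc n))"
    by (rule gbinomial_Suc_Suc)
  then show ?case
    using Suc by (simp add: difference_poly_def poly_gbinomial_poly algebra_simps)
qed

lemma difference_poly_degree:
  assumes "d > 0"
  shows "Polynomial.degree (difference_poly n d) = n" "lead_coeff (difference_poly n d) = of_nat d / fact n"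
proof -
  have c: "Polynomial.coeff (difference_poly n d) n = of_nat d / fact n"
    using lead_coeff_gbinomial_poly by (simp add: difference_poly_def coeff_sum degree_gbinomial_poly)
  have "Polynomial.degree (difference_poly n d) \<le> n"
    unfolding difference_poly_def by (rule degree_sum_le) (auto simp: degree_gbinomial_poly)
  moreover have "n \<le> Polynomial.degree (difference_poly n d)"
    by (rule le_degree) (use c assms in simp)
  ultimately show "Polynomial.degree (difference_poly n d) = n" by simp
  with c show "lead_coeff (difference_poly n d) = of_nat d / fact n" by simp
qed

lemma poly_unique_if_eventually_eq:
  fixes p q :: "rat poly" and F :: "nat \<Rightarrow> rat"
  assumes "eventually (\<lambda>t. F t = poly p (of_nat t)) sequentially"
    and "eventually (\<lambda>t. F t = poly q (of_nat t)) sequentially"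
  shows "p = q"
proof -
  from eventually_conj[OF assms] have "eventually (\<lambda>t. poly p (of_nat t) = poly q (of_nat t)) sequentially"
    by (rule eventually_mono) (elim conjE, simp)
  then obtain N where N: "\<And>t. t \<ge> N \<Longrightarrow> poly p (of_nat t) = poly q (of_nat t)"
    by (auto simp: eventually_sequentially)
  have "infinite (of_nat ` {N..} :: rat set)"
    by (subst finite_image_iff) (auto simp: inj_on_def infinite_Ici)
  moreover have "of_nat ` {N..} \<subseteq> {x. poly (p - q) x = 0}" using N by auto
  ultimately have "infinite {x. poly (p - q) x = 0}" using finite_subset by blast
  then show ?thesis using poly_roots_finite[of "p - q"] by auto
qed

lemma the_eventual_poly:
  fixes p :: "rat poly" and F :: "nat \<Rightarrow> rat"
  assumes "\<And>t. t \<ge> N \<Longrightarrow> F t = poly p (of_nat t)"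
  shows "(THE p. eventually (\<lambda>t. F t = poly p (of_nat t)) sequentially) = p"
proof (rule the_equality)
  show ev: "eventually (\<lambda>t. F t = poly p (of_nat t)) sequentially"
    using assms eventually_sequentially by blast
  show "q = p" if "eventually (\<lambda>t. F t = poly q (of_nat t)) sequentially" for q
    by (rule poly_unique_if_eventually_eq[OF that ev])
qed

lemma of_nat_difference_binomial:
  assumes "d \<le> t + n + 1"
  shows "of_nat ((t + n + 1) choose (n + 1)) - of_nat ((t + n + 1 - d) choose (n + 1))
    = poly (difference_poly n d) (of_nat t)"
proof -
  have "of_nat (t + n + 1) = (of_nat t + of_nat n + 1 :: rat)" by simp
  moreover have "of_nat (t + n + 1 - d) = (of_nat t + of_nat n + 1 - of_nat d :: rat)"
    using assms by (simp add: of_nat_diff)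
  ultimately show ?thesis
    by (simp only: binomial_gbinomial poly_difference_poly)
qed

text \<open>
  One step before the transition the second binomial coefficient has upper entry \<open>-1\<close>; as a polynomial
  value it is \<open>\<plusminus>1\<close>, not zero.
\<close>

lemma poly_difference_poly_before:
  assumes "d = t + n + 2"
  shows "poly (difference_poly n d) (of_nat t) \<noteq> of_nat ((t + n + 1) choose (n + 1))"
proof -
  have "(of_nat t + of_nat n + 1 :: rat) = of_nat (t + n + 1)" by simp
  then have "((of_nat t + of_nat n + 1 :: rat) gchoose (n + 1)) = of_nat ((t + n + 1) choose (n + 1))"
    by (simp only: binomial_gbinomial)
  moreover have "of_nat t + of_nat n + 1 - of_nat d = (- 1 :: rat)" using assms by simp
  moreover have "(- 1 :: rat) gchoose (n + 1) \<noteq> 0"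
    using gbinomial_minus[of "1::rat" "n + 1"] binomial_gbinomial[of "Suc n" "Suc n", where 'a = rat]
    by simp
  ultimately show ?thesis by (simp only: poly_difference_poly)
qed

section \<open>Fundamental domains and lattice indices\<close>

lemma nn_integral_lborel_isometry:
  fixes F :: "'a::euclidean_space \<Rightarrow> ennreal" and c :: real
  assumes F: "F \<in> borel_measurable borel" and c: "\<bar>c\<bar> = 1"
  shows "(\<integral>\<^sup>+x. F (t + c *\<^sub>R x) \<partial>lborel) = (\<integral>\<^sup>+x. F x \<partial>lborel)"
proof -
  have "c \<noteq> 0" using c by auto
  from lborel_affine[OF this, of t]
  have "(\<integral>\<^sup>+x. F x \<partial>lborel) = (\<integral>\<^sup>+x. F x \<partial>density (distr lborel borel (\<lambda>x. t + c *\<^sub>R x)) (\<lambda>_. \<bar>c\<bar> ^ DIM('a)))"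
    by simp
  also have "\<dots> = (\<integral>\<^sup>+x. F (t + c *\<^sub>R x) \<partial>lborel)"
    using F c by (simp add: nn_integral_density nn_integral_distr)
  finally show ?thesis by simp
qed

lemma emeasure_lborel_translate:
  fixes S :: "'a::euclidean_space set"
  assumes "S \<in> sets borel"
  shows "emeasure lborel {x. t + x \<in> S} = emeasure lborel S"
proof -
  have m: "{x. t + x \<in> S} \<in> sets borel"
    using measurable_sets[of "\<lambda>x. t + x" borel borel S] assms by (simp add: vimage_def)
  have "emeasure lborel {x. t + x \<in> S} = (\<integral>\<^sup>+x. indicator {x. t + x \<in> S} x \<partial>lborel)"
    using m by simp
  also have "\<dots> = (\<integral>\<^sup>+x. indicator S (t + 1 *\<^sub>R x) \<partial>lborel)"
    by (simp add: indicator_def)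
  also have "\<dots> = emeasure lborel S"
    using assms by (subst nn_integral_lborel_isometry) auto
  finally show ?thesis .
qed

text \<open>
  \<open>F\<close> is a fundamental domain for translation by \<open>\<Lambda>\<close>. For a subgroup \<open>\<Lambda>\<close> of a discrete group the same
  predicate says that \<open>F\<close> is a system of coset representatives; the roles of the two sets may also
  be exchanged in a commutative group.
\<close>

definition tiles :: "'a::group_add set \<Rightarrow> 'a set \<Rightarrow> bool" where
  "tiles \<Lambda> F \<longleftrightarrow> (\<forall>x. \<exists>!l. l \<in> \<Lambda> \<and> - l + x \<in> F)"

text \<open>
  Cut \<open>F\<close> along the translates of \<open>G\<close>. Moving the piece \<open>F \<inter> (l + G)\<close> by \<open>-l\<close> gives \<open>(-l + F) \<inter> G\<close>,
  and these are the pieces of \<open>G\<close> cut along the translates of \<open>F\<close>.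
\<close>

lemma emeasure_eq_if_tiles:
  fixes F G :: "'a::euclidean_space set"
  assumes "countable \<Lambda>" and minus: "\<And>l. l \<in> \<Lambda> \<Longrightarrow> - l \<in> \<Lambda>"
    and [measurable]: "F \<in> sets borel" "G \<in> sets borel" and "tiles \<Lambda> F" "tiles \<Lambda> G"
  shows "emeasure lborel F = emeasure lborel G"
proof -
  have pieces: "emeasure lborel F = (\<integral>\<^sup>+l. emeasure lborel {x. x \<in> F \<and> - l + x \<in> G} \<partial>count_space \<Lambda>)"
    if "F \<in> sets borel" "G \<in> sets borel" "tiles \<Lambda> G" for F G :: "'a set"
  proof -
    have "F = (\<Union>l\<in>\<Lambda>. {x. x \<in> F \<and> - l + x \<in> G})"
      using that(3) unfolding tiles_def by auto
    then have "emeasure lborel F = emeasure lborel (\<Union>l\<in>\<Lambda>. {x. x \<in> F \<and> - l + x \<in> G})" by simp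
    also have "\<dots> = (\<integral>\<^sup>+l. emeasure lborel {x. x \<in> F \<and> - l + x \<in> G} \<partial>count_space \<Lambda>)"
    proof (rule emeasure_UN_countable)
      fix l :: 'a
      have "F \<inter> ((\<lambda>x. - l + x) -` G \<inter> space borel) \<in> sets borel"
        using that(1,2) by (intro sets.Int measurable_sets[of _ borel borel]) auto
      then show "{x. x \<in> F \<and> - l + x \<in> G} \<in> sets lborel"
        by (simp add: vimage_def Int_def)
      show "disjoint_family_on (\<lambda>l. {x. x \<in> F \<and> - l + x \<in> G}) \<Lambda>"
        using that(3) unfolding tiles_def disjoint_family_on_def by auto
    qed (rule assms(1))
    finally show ?thesis .
  qed
  have swap: "emeasure lborel {x. x \<in> F \<and> - l + x \<in> G} = emeasure lborel {x. x \<in> G \<and> - (- l) + x \<in> F}" for l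
  proof -
    have "F \<inter> ((\<lambda>x. - l + x) -` G \<inter> space borel) \<in> sets borel"
      by (intro sets.Int measurable_sets[of _ borel borel]) auto
    then have "{x. x \<in> F \<and> - l + x \<in> G} \<in> sets borel" by (simp add: vimage_def Int_def)
    then have "emeasure lborel {x. x \<in> F \<and> - l + x \<in> G}
        = emeasure lborel {x. l + x \<in> {x. x \<in> F \<and> - l + x \<in> G}}"
      by (rule emeasure_lborel_translate[symmetric])
    also have "{x. l + x \<in> {x. x \<in> F \<and> - l + x \<in> G}} = {x. x \<in> G \<and> - (- l) + x \<in> F}"
      by auto
    finally show ?thesis .
  qed
  have "bij_betw uminus \<Lambda> \<Lambda>"
    using minus by (intro bij_betwI[of _ _ _ uminus]) auto
  then have "(\<integral>\<^sup>+l. emeasure lborel {x. x \<in> G \<and> - (- l) + x \<in> F} \<partial>count_space \<Lambda>)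
      = (\<integral>\<^sup>+l. emeasure lborel {x. x \<in> G \<and> - l + x \<in> F} \<partial>count_space \<Lambda>)"
    by (rule nn_integral_bij_count_space)
  with pieces[of F G] pieces[of G F] assms show ?thesis by (simp only: swap)
qed

text \<open>
  A linear bijection scales all volumes by one factor, by uniqueness of translation-invariant measures:
  \<open>B \<mapsto> vol (f ` B)\<close> is invariant, and the double integral of \<open>1\<^sub>A(x) 1\<^sub>B(g y + x)\<close>, with \<open>g\<close> the inverse of
  \<open>f\<close>, evaluated in both orders, compares it with the volume. The symmetric form avoids naming the
  factor.
\<close>

lemma emeasure_linear_image:
  fixes f :: "'a::euclidean_space \<Rightarrow> 'a"
  assumes f: "linear f" "inj f" and A: "A \<in> sets borel" and B: "B \<in> sets borel"
  shows "f ` B \<in> sets borel"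
    and "emeasure lborel A * emeasure lborel (f ` B) = emeasure lborel (f ` A) * emeasure lborel B"
proof -
  obtain g where g: "linear g" "\<And>x. g (f x) = x" "\<And>x. f (g x) = x"
    using linear_injective_isomorphism[OF f] by auto
  have gm [measurable]: "g \<in> borel_measurable borel"
    using g(1) by (intro borel_measurable_continuous_onI linear_continuous_on linear_conv_bounded_linear[THEN iffD1])
  have im: "f ` S = {y. g y \<in> S}" for S
    by (auto simp: g(2)) (metis g(3) imageI)
  have im_borel: "f ` S \<in> sets borel" if "S \<in> sets borel" for S
    using measurable_sets[OF gm that] by (simp add: im vimage_def)
  show "f ` B \<in> sets borel" by (rule im_borel[OF B])
  note [measurable] = A B
  have vol: "emeasure lborel (f ` S) = (\<integral>\<^sup>+y. indicator S (g y) \<partial>lborel)" if "S \<in> sets borel" for S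
  proof -
    have "emeasure lborel (f ` S) = (\<integral>\<^sup>+y. indicator (f ` S) y \<partial>lborel)"
      using im_borel[OF that] by simp
    also have "\<dots> = (\<integral>\<^sup>+y. indicator S (g y) \<partial>lborel)"
      by (simp add: im indicator_def)
    finally show ?thesis .
  qed
  have gadd: "g (x + y) = g x + g y" "g (- x) = - g x" for x y
    using g(1) by (simp_all add: linear_add linear_neg)
  have "emeasure lborel A * emeasure lborel (f ` B)
      = (\<integral>\<^sup>+x. indicator A x * (\<integral>\<^sup>+y. indicator B (g y) \<partial>lborel) \<partial>lborel)"
    by (simp add: vol B nn_integral_multc)
  \<comment> \<open>Shift \<open>y\<close> by \<open>f x\<close>; in the other order of integration, shift \<open>x\<close> by \<open>- g y\<close>.\<close>
  also have "\<dots> = (\<integral>\<^sup>+x. \<integral>\<^sup>+y. indicator A x * indicator B (g y + x) \<partial>lborel \<partial>lborel)"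
  proof (rule nn_integral_cong)
    fix x
    have "(\<integral>\<^sup>+y. indicator B (g (f x + 1 *\<^sub>R y)) \<partial>lborel) = (\<integral>\<^sup>+y. indicator B (g y) \<partial>lborel :: ennreal)"
      by (rule nn_integral_lborel_isometry) auto
    then show "indicator A x * (\<integral>\<^sup>+y. indicator B (g y) \<partial>lborel)
        = (\<integral>\<^sup>+y. indicator A x * indicator B (g y + x) \<partial>lborel :: ennreal)"
      by (simp add: nn_integral_cmult gadd g(2) add.commute)
  qed
  also have "\<dots> = (\<integral>\<^sup>+y. \<integral>\<^sup>+x. indicator A x * indicator B (g y + x) \<partial>lborel \<partial>lborel)"
    by (rule lborel_pair.Fubini'[symmetric]) measurable
  also have "\<dots> = (\<integral>\<^sup>+y. \<integral>\<^sup>+x. indicator A (- g y + x) * indicator B x \<partial>lborel \<partial>lborel)"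
  proof (rule nn_integral_cong)
    fix y
    have "(\<integral>\<^sup>+x. indicator A (- g y + (g y + 1 *\<^sub>R x)) * indicator B (g y + 1 *\<^sub>R x) \<partial>lborel)
        = (\<integral>\<^sup>+x. indicator A (- g y + x) * indicator B x \<partial>lborel :: ennreal)"
      by (rule nn_integral_lborel_isometry) auto
    then show "(\<integral>\<^sup>+x. indicator A x * indicator B (g y + x) \<partial>lborel)
        = (\<integral>\<^sup>+x. indicator A (- g y + x) * indicator B x \<partial>lborel :: ennreal)" by simp
  qed
  also have "\<dots> = (\<integral>\<^sup>+x. \<integral>\<^sup>+y. indicator A (- g y + x) * indicator B x \<partial>lborel \<partial>lborel)"
    by (rule lborel_pair.Fubini') measurable
  \<comment> \<open>Reflect \<open>y\<close> to \<open>f x - y\<close>, which turns \<open>- g y + x\<close> into \<open>g y\<close>.\<close>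
  also have "\<dots> = (\<integral>\<^sup>+x. (\<integral>\<^sup>+y. indicator A (g y) \<partial>lborel) * indicator B x \<partial>lborel)"
  proof (rule nn_integral_cong)
    fix x
    have "(\<integral>\<^sup>+y. indicator A (g (f x + (- 1) *\<^sub>R y)) \<partial>lborel) = (\<integral>\<^sup>+y. indicator A (g y) \<partial>lborel :: ennreal)"
      by (rule nn_integral_lborel_isometry) auto
    then show "(\<integral>\<^sup>+y. indicator A (- g y + x) * indicator B x \<partial>lborel)
        = (\<integral>\<^sup>+y. indicator A (g y) \<partial>lborel) * (indicator B x :: ennreal)"
      using gadd(1)[of "f x" "- y" for y] by (simp add: nn_integral_multc gadd g(2) linear_diff[OF g(1)] add.commute)
  qed
  also have "\<dots> = emeasure lborel (f ` A) * emeasure lborel B"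
    by (simp add: vol A nn_integral_cmult)
  finally show "emeasure lborel A * emeasure lborel (f ` B) = emeasure lborel (f ` A) * emeasure lborel B" .
qed

definition half_open_cube :: "(real ^ 'n) set" where
  "half_open_cube = {x. \<forall>i. 0 \<le> x $ i \<and> x $ i < 1}"

lemma half_open_cube_borel [measurable]: "half_open_cube \<in> sets borel"
proof -
  have eq: "half_open_cube = (\<Inter>i. {x :: real ^ 'n. 0 \<le> x $ i} \<inter> {x. x $ i < 1})"
    by (auto simp: half_open_cube_def)
  have "{x :: real ^ 'n. 0 \<le> x $ i} \<in> sets borel" for i
    by (intro borel_closed closed_Collect_le continuous_intros)
  moreover have "{x :: real ^ 'n. x $ i < 1} \<in> sets borel" for i
    by (intro borel_open open_Collect_less continuous_intros)
  ultimately show ?thesis unfolding eq by (intro sets.finite_INT sets.Int) auto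
qed

lemma emeasure_half_open_cube: "emeasure lborel (half_open_cube :: (real ^ 'n) set) = 1"
proof (rule antisym)
  let ?one = "(\<chi> i. 1) :: real ^ 'n"
  have one: "?one \<bullet> b = 1" if "b \<in> Basis" for b
    using that by (auto simp: Basis_vec_def inner_axis)
  have "half_open_cube \<subseteq> cbox 0 ?one"
    by (auto simp: half_open_cube_def mem_box_cart less_imp_le)
  from emeasure_mono[OF this, of lborel] show "emeasure lborel (half_open_cube :: (real ^ 'n) set) \<le> 1"
    by (simp add: emeasure_lborel_cbox_eq one)
  have "box 0 ?one \<subseteq> half_open_cube"
    by (auto simp: half_open_cube_def mem_box_cart less_imp_le)
  from emeasure_mono[OF this, of lborel] show "1 \<le> emeasure lborel (half_open_cube :: (real ^ 'n) set)"
    by (simp add: emeasure_lborel_box_eq one)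
qed

definition real_of_int_vec :: "int ^ 'n \<Rightarrow> real ^ 'n" where
  "real_of_int_vec z = (\<chi> i. real_of_int (z $ i))"

lemma real_of_int_vec_simps [simp]:
  "real_of_int_vec (y + z) = real_of_int_vec y + real_of_int_vec z"
  "real_of_int_vec (- z) = - real_of_int_vec z"
  "real_of_int_vec y = real_of_int_vec z \<longleftrightarrow> y = z"
  by (auto simp: real_of_int_vec_def vec_eq_iff)

lemma tiles_half_open_cube: "tiles (range real_of_int_vec) (half_open_cube :: (real ^ 'n) set)"
  unfolding tiles_def
proof (intro allI ex_ex1I)
  fix x :: "real ^ 'n"
  have "- real_of_int_vec (\<chi> i. \<lfloor>x $ i\<rfloor>) + x \<in> half_open_cube"
    by (auto simp: half_open_cube_def real_of_int_vec_def) linarith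
  then show "\<exists>l. l \<in> range real_of_int_vec \<and> - l + x \<in> half_open_cube" by blast
next
  fix x l l' :: "real ^ 'n"
  assume "l \<in> range real_of_int_vec \<and> - l + x \<in> half_open_cube"
    "l' \<in> range real_of_int_vec \<and> - l' + x \<in> half_open_cube"
  then obtain z z' where z: "l = real_of_int_vec z" "l' = real_of_int_vec z'"
    "- real_of_int_vec z + x \<in> half_open_cube" "- real_of_int_vec z' + x \<in> half_open_cube" by blast
  have "z $ i = \<lfloor>x $ i\<rfloor>" "z' $ i = \<lfloor>x $ i\<rfloor>" for i
    using z(3,4)[unfolded half_open_cube_def mem_Collect_eq, rule_format, of i]
    by (auto simp: real_of_int_vec_def intro!: floor_unique[symmetric])
  then have "z = z'" by (simp add: vec_eq_iff)
  then show "l = l'" using z(1,2) by simp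
qed

text \<open>
  The volume of a fundamental parallelepiped is the index of its lattice. The parallelepiped
  \<open>f ` half_open_cube\<close> and the union of the unit cubes at the points of a transversal \<open>T\<close> both tile
  with respect to the same lattice, and the second one has as many unit cubes as \<open>T\<close> has elements.
\<close>

lemma emeasure_image_cube_eq_card_transversal:
  fixes f :: "real ^ 'n \<Rightarrow> real ^ 'n" and T L :: "(int ^ 'n) set"
  assumes f: "linear f" "inj f" and L: "f ` range real_of_int_vec = real_of_int_vec ` L"
    and T: "tiles L T"
  shows "emeasure lborel (f ` half_open_cube) = emeasure (count_space UNIV) T"
proof -
  let ?e = "real_of_int_vec :: int ^ 'n \<Rightarrow> real ^ 'n" and ?C = "half_open_cube :: (real ^ 'n) set"
  define G where "G = (\<Union>t\<in>T. {x. - ?e t + x \<in> ?C})"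
  obtain g where g: "\<And>x. g (f x) = x" "\<And>x. f (g x) = x"
    using linear_injective_isomorphism[OF f] by auto
  have cz: "countable (UNIV :: (int ^ 'n) set)" by (rule countableI_type)
  then have cT: "countable T" by (rule countable_subset[rotated]) simp
  have cube: "\<exists>!z. - ?e z + x \<in> ?C" for x
  proof -
    have ex1: "\<exists>!l. l \<in> range ?e \<and> - l + x \<in> ?C"
      by (rule tiles_half_open_cube[unfolded tiles_def, rule_format])
    show ?thesis
    proof (rule ex_ex1I)
      show "\<exists>z. - ?e z + x \<in> ?C" using ex1 by blast
      show "z = z'" if "- ?e z + x \<in> ?C" "- ?e z' + x \<in> ?C" for z z'
      proof -
        have "?e z = ?e z'" using ex1 that by blast
        then show ?thesis by simp
      qed
    qed
  qed
  have piece: "{x. - ?e t + x \<in> ?C} \<in> sets borel" "emeasure lborel {x. - ?e t + x \<in> ?C} = 1" for t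
  proof -
    show "{x. - ?e t + x \<in> ?C} \<in> sets borel"
      using measurable_sets[of "\<lambda>x. - ?e t + x" borel borel ?C] by (simp add: vimage_def)
    show "emeasure lborel {x. - ?e t + x \<in> ?C} = 1"
      by (simp only: emeasure_lborel_translate[OF half_open_cube_borel] emeasure_half_open_cube)
  qed
  have "emeasure lborel G = (\<integral>\<^sup>+t. emeasure lborel {x. - ?e t + x \<in> ?C} \<partial>count_space T)"
    unfolding G_def
  proof (rule emeasure_UN_countable)
    show "disjoint_family_on (\<lambda>t. {x. - ?e t + x \<in> ?C}) T"
      using cube unfolding disjoint_family_on_def by auto
    show "{x. - ?e t + x \<in> ?C} \<in> sets lborel" for t using piece(1) by simp
  qed (rule cT)
  also have "\<dots> = emeasure (count_space UNIV) T"
    by (simp only: piece(2) nn_integral_const) (simp add: emeasure_count_space)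
  finally have G: "emeasure lborel G = emeasure (count_space UNIV) T" .
  have Gb: "G \<in> sets borel" unfolding G_def by (intro sets.countable_UN'[OF cT] image_subsetI piece(1))
  have "tiles (?e ` L) (f ` ?C)"
    unfolding tiles_def
  proof (rule allI)
    fix x
    have ex1: "\<exists>!l. l \<in> range ?e \<and> - l + g x \<in> ?C"
      by (rule tiles_half_open_cube[unfolded tiles_def, rule_format])
    have iff: "- f l + x \<in> f ` ?C \<longleftrightarrow> - l + g x \<in> ?C" for l
    proof -
      have "- f l + x = f (- l + g x)" using linear_add[OF f(1), of "- l" "g x"] linear_neg[OF f(1), of l] g(2)[of x] by simp
      then show ?thesis using f(2) by (simp add: inj_image_mem_iff)
    qed
    have "\<exists>!l. l \<in> f ` range ?e \<and> - l + x \<in> f ` ?C"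
    proof (rule ex_ex1I)
      from ex1 obtain k where "k \<in> range ?e" "- f k + x \<in> f ` ?C" unfolding iff by blast
      then show "\<exists>l. l \<in> f ` range ?e \<and> - l + x \<in> f ` ?C" by blast
      fix l l' assume "l \<in> f ` range ?e \<and> - l + x \<in> f ` ?C" "l' \<in> f ` range ?e \<and> - l' + x \<in> f ` ?C"
      then obtain k k' where k: "l = f k" "l' = f k'" "k \<in> range ?e" "k' \<in> range ?e"
        "- f k + x \<in> f ` ?C" "- f k' + x \<in> f ` ?C" by blast
      then have "k = k'" using ex1 unfolding iff by blast
      with k show "l = l'" by simp
    qed
    then show "\<exists>!l. l \<in> ?e ` L \<and> - l + x \<in> f ` ?C" by (simp only: L)
  qed
  moreover have "tiles (?e ` L) G"
    unfolding tiles_def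
  proof (rule allI)
    fix x
    obtain z where z: "- ?e z + x \<in> ?C" and uniq: "\<And>z'. - ?e z' + x \<in> ?C \<Longrightarrow> z' = z"
      using cube[of x] by blast
    have iff: "- ?e l + x \<in> G \<longleftrightarrow> - l + z \<in> T" for l
    proof -
      have *: "- ?e t + (- ?e l + x) = - ?e (l + t) + x" for t by simp
      have "- ?e l + x \<in> G \<longleftrightarrow> (\<exists>t\<in>T. - ?e (l + t) + x \<in> ?C)"
        unfolding G_def by (simp only: UN_iff mem_Collect_eq *)
      also have "\<dots> \<longleftrightarrow> (\<exists>t\<in>T. t = - l + z)"
      proof -
        have "- ?e y + x \<in> ?C \<longleftrightarrow> y = z" for y using z uniq by blast
        moreover have "l + t = z \<longleftrightarrow> t = - l + z" for t by (auto simp: algebra_simps)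
        ultimately show ?thesis by (simp only:)
      qed
      also have "\<dots> \<longleftrightarrow> - l + z \<in> T" by simp
      finally show ?thesis .
    qed
    have ex1: "\<exists>!l. l \<in> L \<and> - l + z \<in> T" by (rule T[unfolded tiles_def, rule_format])
    show "\<exists>!l. l \<in> ?e ` L \<and> - l + x \<in> G"
    proof (rule ex_ex1I)
      from ex1 obtain k where "k \<in> L" "- ?e k + x \<in> G" unfolding iff by blast
      then show "\<exists>l. l \<in> ?e ` L \<and> - l + x \<in> G" by blast
      fix l l' assume "l \<in> ?e ` L \<and> - l + x \<in> G" "l' \<in> ?e ` L \<and> - l' + x \<in> G"
      then obtain k k' where k: "l = ?e k" "l' = ?e k'" "k \<in> L" "k' \<in> L"
        "- ?e k + x \<in> G" "- ?e k' + x \<in> G" by blast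
      then have "k = k'" using ex1 unfolding iff by blast
      with k show "l = l'" by simp
    qed
  qed
  moreover have "- l \<in> ?e ` L" if l: "l \<in> ?e ` L" for l
  proof -
    from l have "l \<in> f ` range ?e" by (simp only: L)
    then obtain z where "l = f (?e z)" by blast
    then have "- l = f (?e (- z))" by (simp add: linear_neg[OF f(1)])
    then have "- l \<in> f ` range ?e" by blast
    then show ?thesis by (simp only: L)
  qed
  moreover have "countable (?e ` L)" by (rule countable_image) (rule countable_subset[OF subset_UNIV cz])
  moreover have "f ` ?C \<in> sets borel" by (rule emeasure_linear_image(1)[OF f half_open_cube_borel half_open_cube_borel])
  ultimately have "emeasure lborel (f ` ?C) = emeasure lborel G"
    using Gb by (intro emeasure_eq_if_tiles[of "?e ` L"])
  then show ?thesis using G by simp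
qed

section \<open>The difference group\<close>

definition weighted_sum :: "(nat ^ 'n) set \<Rightarrow> (nat ^ 'n \<Rightarrow> int) \<Rightarrow> int ^ 'n" where
  "weighted_sum A v = (\<Sum>a\<in>A. v a *s int_vec a)"

lemma weighted_sum_component: "weighted_sum A v $ i = (\<Sum>a\<in>A. v a * int (a $ i))"
  by (simp add: weighted_sum_def int_vec_def)

lemma weighted_sum_diff: "weighted_sum A (\<lambda>a. v a - w a) = weighted_sum A v - weighted_sum A w"
  by (simp add: vec_eq_iff weighted_sum_component left_diff_distrib sum_subtractf)

lemma weighted_sum_scale: "weighted_sum A (\<lambda>a. c * v a) = c *s weighted_sum A v"
  by (simp add: vec_eq_iff weighted_sum_component sum_distrib_left mult.assoc)

lemma weighted_sum_unit:
  assumes "finite A" "b \<in> A"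
  shows "weighted_sum A (\<lambda>a. if a = b then c else 0) = c *s int_vec b"
proof -
  have "weighted_sum A (\<lambda>a. if a = b then c else 0) = (\<Sum>a\<in>A. if a = b then c *s int_vec a else 0)"
    unfolding weighted_sum_def by (intro sum.cong) auto
  with assms show ?thesis by simp
qed

lemma affine_relations_iff:
  "v \<in> affine_relations A \<longleftrightarrow> (\<forall>a. a \<notin> A \<longrightarrow> v a = 0) \<and> (\<Sum>a\<in>A. v a) = 0 \<and> weighted_sum A v = 0"
  by (simp add: affine_relations_def vec_eq_iff weighted_sum_component)

lemma group_closure_int_scale:
  fixes x :: "int ^ 'n"
  assumes "x \<in> group_closure S"
  shows "c *s x \<in> group_closure S"
proof (induction c rule: int_induct[where k = 0])
  case (step1 c)
  have "(c + 1) *s x = c *s x + x" by (simp add: vec_eq_iff algebra_simps)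
  with step1 assms show ?case by (simp add: group_closure_add)
next
  case (step2 c)
  have "(c - 1) *s x = c *s x - x" by (simp add: vec_eq_iff algebra_simps)
  with step2 assms show ?case by (simp add: group_closure.diff)
qed simp

lemma group_closure_sum_vec:
  fixes f :: "'i \<Rightarrow> int ^ 'n"
  shows "(\<And>i. i \<in> I \<Longrightarrow> f i \<in> group_closure S) \<Longrightarrow> sum f I \<in> group_closure S"
  by (induction I rule: infinite_finite_induct) (auto intro: group_closure_add)

lemma difference_group_eq:
  fixes A :: "(nat ^ 'n) set"
  assumes "finite A" "A \<noteq> {}"
  shows "difference_group A = weighted_sum A ` {v. (\<Sum>a\<in>A. v a) = 0}"
proof (intro equalityI subsetI)
  fix x assume "x \<in> difference_group A"
  then show "x \<in> weighted_sum A ` {v. (\<Sum>a\<in>A. v a) = 0}"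
    unfolding difference_group_def
  proof (induction rule: group_closure.induct)
    case (base s)
    show ?case
    proof (cases "s = 0")
      case True
      have "weighted_sum A (\<lambda>_. 0) = 0" by (simp add: weighted_sum_def)
      with True show ?thesis by (intro image_eqI[of _ _ "\<lambda>_. 0"]) auto
    next
      case False
      then obtain a b where ab: "s = int_vec a - int_vec b" "a \<in> A" "b \<in> A" using base by auto
      let ?v = "\<lambda>c. (if c = a then 1 else 0) - (if c = b then 1 else 0 :: int)"
      have "weighted_sum A ?v = s"
        using ab assms(1) by (simp add: weighted_sum_diff weighted_sum_unit)
      moreover have "(\<Sum>c\<in>A. ?v c) = 0" using ab assms(1) by (simp add: sum_subtractf)
      ultimately show ?thesis by blast
    qed
  next
    case (diff s t)
    then obtain v w where vw: "s = weighted_sum A v" "(\<Sum>a\<in>A. v a) = 0" "t = weighted_sum A w" "(\<Sum>a\<in>A. w a) = 0"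
      by auto
    then have "(\<Sum>a\<in>A. v a - w a) = 0" by (simp add: sum_subtractf)
    moreover have "s - t = weighted_sum A (\<lambda>a. v a - w a)" using vw by (simp add: weighted_sum_diff)
    ultimately show ?case by blast
  qed
next
  fix x assume "x \<in> weighted_sum A ` {v. (\<Sum>a\<in>A. v a) = 0}"
  then obtain v where v: "x = weighted_sum A v" "(\<Sum>a\<in>A. v a) = 0" by blast
  obtain b where b: "b \<in> A" using assms(2) by blast
  have "(\<Sum>a\<in>A. v a *s (int_vec a - int_vec b)) = weighted_sum A v - (\<Sum>a\<in>A. v a) *s int_vec b"
    by (simp add: vec_eq_iff weighted_sum_component int_vec_def right_diff_distrib sum_subtractf sum_distrib_right)
  then have "x = (\<Sum>a\<in>A. v a *s (int_vec a - int_vec b))" using v by simp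
  also have "\<dots> \<in> difference_group A"
    unfolding difference_group_def
    by (intro group_closure_sum_vec group_closure_int_scale group_closure.base) (use b in auto)
  finally show "x \<in> difference_group A" .
qed

text \<open>
  Here \<open>tiles R H\<close> is read with \<open>R\<close> as the set of translations: every element is congruent modulo \<open>H\<close>
  to exactly one element of \<open>R\<close>.
\<close>

lemma ex_coset_representatives:
  fixes H :: "'a::ab_group_add set"
  assumes zero: "0 \<in> H" and diff: "\<And>x y. x \<in> H \<Longrightarrow> y \<in> H \<Longrightarrow> x - y \<in> H"
  obtains R where "tiles R H" "card R = subgroup_index H" 
proof -
  define E where "E = {(x, y). x - y \<in> H}"
  have minus: "- x \<in> H" if "x \<in> H" for x using diff[OF zero that] by simp
  have add: "x + y \<in> H" if "x \<in> H" "y \<in> H" for x y using diff[OF that(1) minus[OF that(2)]] by simp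
  have E: "equiv UNIV E"
  proof (rule equivI)
    show "refl E" by (auto simp: E_def refl_on_def zero)
    show "sym E" using minus by (auto simp: E_def sym_def) (metis minus_diff_eq)
    show "trans E" using add by (auto simp: E_def trans_def) (metis add_diff_eq diff_add_cancel)
  qed auto
  define rep where "rep = (\<lambda>C :: 'a set. SOME x. x \<in> C)"
  have rep: "rep C \<in> C" if "C \<in> UNIV // E" for C
    unfolding rep_def using in_quotient_imp_non_empty[OF E that] by (intro some_in_eq[THEN iffD2])
  have class_rep: "E `` {rep C} = C" if "C \<in> UNIV // E" for C
    using rep[OF that] that by (metis E Image_singleton_iff equiv_class_eq_iff quotientE)
  have inj: "inj_on rep (UNIV // E)" using class_rep by (metis inj_onI)
  define R where "R = rep ` (UNIV // E)"
  have "tiles R H"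
    unfolding tiles_def
  proof (intro allI ex_ex1I)
    fix x
    have C: "E `` {x} \<in> UNIV // E" by (rule quotientI) simp
    then have "rep (E `` {x}) \<in> E `` {x}" by (rule rep)
    then have "x - rep (E `` {x}) \<in> H" by (simp add: E_def)
    with C show "\<exists>l. l \<in> R \<and> - l + x \<in> H" by (auto simp: R_def)
  next
    fix x l l' assume *: "l \<in> R \<and> - l + x \<in> H" "l' \<in> R \<and> - l' + x \<in> H"
    then obtain C C' where C: "C \<in> UNIV // E" "C' \<in> UNIV // E" "l = rep C" "l' = rep C'"
      by (auto simp: R_def)
    have "(x, l) \<in> E" "(x, l') \<in> E" using * by (auto simp: E_def)
    then have "E `` {l} = E `` {x}" "E `` {l'} = E `` {x}" using equiv_class_eq[OF E] by metis+
    then show "l = l'" using C class_rep by metis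
  qed
  moreover have "card R = subgroup_index H"
    unfolding R_def subgroup_index_def by (simp add: card_image[OF inj] flip: E_def)
  ultimately show ?thesis using that by blast
qed

section \<open>Lattices and volumes of the simplices on all points but one\<close>

context single_relation
begin

definition simplex_lattice :: "nat ^ 'n \<Rightarrow> (int ^ 'n) set" where
  "simplex_lattice i = weighted_sum A ` {v. (\<Sum>a\<in>A. v a) = 0 \<and> v i = 0}"

lemma A_nonempty: "A \<noteq> {}"
  using card_A by auto

lemma difference_group_A: "difference_group A = weighted_sum A ` {v. (\<Sum>a\<in>A. v a) = 0}"
  by (rule difference_group_eq[OF finite_A A_nonempty])

lemma simplex_lattice_subset: "simplex_lattice i \<subseteq> difference_group A"
  by (auto simp: simplex_lattice_def difference_group_A)

lemma difference_group_ops: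
  "0 \<in> difference_group A"
  "x \<in> difference_group A \<Longrightarrow> y \<in> difference_group A \<Longrightarrow> x - y \<in> difference_group A"
  "x \<in> difference_group A \<Longrightarrow> y \<in> difference_group A \<Longrightarrow> x + y \<in> difference_group A"
  "x \<in> difference_group A \<Longrightarrow> c *s x \<in> difference_group A"
  "i \<in> A \<Longrightarrow> j \<in> A \<Longrightarrow> int_vec i - int_vec j \<in> difference_group A"
  by (auto simp: difference_group_def intro: group_closure.intros group_closure_add group_closure_int_scale)

lemma simplex_lattice_diff:
  assumes "x \<in> simplex_lattice i" "y \<in> simplex_lattice i"
  shows "x - y \<in> simplex_lattice i"
proof -
  obtain v w where "x = weighted_sum A v" "(\<Sum>a\<in>A. v a) = 0" "v i = 0"
    "y = weighted_sum A w" "(\<Sum>a\<in>A. w a) = 0" "w i = 0"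
    using assms by (auto simp: simplex_lattice_def)
  then have "x - y = weighted_sum A (\<lambda>a. v a - w a)" "(\<Sum>a\<in>A. v a - w a) = 0" "v i - w i = 0"
    by (simp_all add: weighted_sum_diff sum_subtractf)
  then show ?thesis unfolding simplex_lattice_def by blast
qed

lemma weighted_sum_edge:
  assumes "i \<in> A" "j \<in> A"
  shows "weighted_sum A (\<lambda>a. (if a = i then k else 0) - (if a = j then k else 0)) = k *s (int_vec i - int_vec j)"
    and "(\<Sum>a\<in>A. (if a = i then k else 0) - (if a = j then k else 0)) = (0 :: int)"
  using assms finite_A
  by (simp_all add: weighted_sum_diff weighted_sum_unit vector_ssub_ldistrib sum_subtractf)

text \<open>
  Subtracting a multiple of \<open>u\<close> from the coefficients does not change the sum and brings the coefficient
  at \<open>i\<close> into the range \<open>{0..<\<bar>u i\<bar>}\<close>; that coefficient is then moved to \<open>j\<close> along the edge.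
\<close>

lemma simplex_lattice_coset:
  assumes "i \<in> A" "j \<in> A" "i \<noteq> j" "u i \<noteq> 0" "l \<in> difference_group A"
  shows "\<exists>k\<in>{0..<\<bar>u i\<bar>}. l - k *s (int_vec i - int_vec j) \<in> simplex_lattice i"
proof -
  obtain v where v: "l = weighted_sum A v" "(\<Sum>a\<in>A. v a) = 0"
    using assms(5) by (auto simp: difference_group_A)
  define k where "k = v i mod \<bar>u i\<bar>"
  have "u i dvd v i - k" by (simp add: k_def minus_mod_eq_mult_div)
  then obtain q where q: "v i - k = q * u i" by (auto simp: dvd_def mult.commute)
  define e where "e = (\<lambda>a. (if a = i then k else 0) - (if a = j then k else 0))"
  define w where "w = (\<lambda>a. v a - q * u a - e a)"
  have "weighted_sum A w = l - k *s (int_vec i - int_vec j)"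
    using u_rel v weighted_sum_edge(1)[OF assms(1,2), of k]
    by (simp add: w_def weighted_sum_diff weighted_sum_scale affine_relations_iff e_def)
  moreover have "(\<Sum>a\<in>A. w a) = 0"
    using u_rel v weighted_sum_edge(2)[OF assms(1,2), of k]
    by (simp add: w_def sum_subtractf affine_relations_iff e_def flip: sum_distrib_left)
  moreover have "w i = 0" using q assms(3) by (simp add: w_def e_def)
  ultimately have "l - k *s (int_vec i - int_vec j) \<in> simplex_lattice i"
    unfolding simplex_lattice_def by (metis (mono_tags, lifting) image_eqI mem_Collect_eq)
  moreover have "k \<in> {0..<\<bar>u i\<bar>}" using assms(4) by (simp add: k_def)
  ultimately show ?thesis by blast
qed

text \<open>
  If a multiple of the edge from \<open>j\<close> to \<open>i\<close> can be written without \<open>i\<close>, the difference of the two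
  expressions is an affine relation, hence a multiple of \<open>u\<close>.
\<close>

lemma simplex_lattice_multiple:
  assumes "i \<in> A" "j \<in> A" "i \<noteq> j" "k *s (int_vec i - int_vec j) \<in> simplex_lattice i"
  shows "u i dvd k"
proof -
  obtain w where w: "k *s (int_vec i - int_vec j) = weighted_sum A w" "(\<Sum>a\<in>A. w a) = 0" "w i = 0"
    using assms(4) by (auto simp: simplex_lattice_def)
  define e where "e = (\<lambda>a. (if a = i then k else 0) - (if a = j then k else 0))"
  define v where "v = (\<lambda>a. if a \<in> A then e a - w a else 0)"
  have "weighted_sum A v = weighted_sum A (\<lambda>a. e a - w a)"
    unfolding weighted_sum_def by (intro sum.cong) (auto simp: v_def)
  also have "\<dots> = 0"
    using w weighted_sum_edge(1)[OF assms(1,2), of k] by (simp add: weighted_sum_diff e_def)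
  finally have "weighted_sum A v = 0" .
  moreover have "(\<Sum>a\<in>A. v a) = 0"
    using w weighted_sum_edge(2)[OF assms(1,2), of k] by (simp add: v_def sum_subtractf e_def)
  ultimately have "v \<in> affine_relations A" by (simp add: affine_relations_iff v_def)
  then obtain q where "v = (\<lambda>a. q * u a)" using u_generates by blast
  then have "v i = q * u i" by simp
  then show ?thesis using assms(1,3) w(3) by (simp add: v_def e_def)
qed

text \<open>
  The two preceding lemmas say that the multiples of an edge by \<open>0, \<dots>, \<bar>u i\<bar> - 1\<close> represent the cosets of
  the simplex lattice in the difference group. Composing with coset representatives of the difference
  group in the whole integer lattice gives representatives for the simplex lattice.
\<close>

lemma simplex_lattice_transversal:
  assumes "i \<in> A" "j \<in> A" "i \<noteq> j" "u i \<noteq> 0" and R: "tiles R (difference_group A)"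
  defines "t \<equiv> \<lambda>(r, k). r + k *s (int_vec i - int_vec j)"
  shows "inj_on t (R \<times> {0..<\<bar>u i\<bar>})" "tiles (simplex_lattice i) (t ` (R \<times> {0..<\<bar>u i\<bar>}))"
proof -
  let ?L = "difference_group A"
  define d where "d = int_vec i - int_vec j"
  have t: "t (r, k) = r + k *s d" for r k by (simp add: t_def d_def)
  have dL: "k *s d \<in> ?L" for k
    unfolding d_def by (intro difference_group_ops assms(1,2))
  have k_unique: "k = k'" if "k \<in> {0..<\<bar>u i\<bar>}" "k' \<in> {0..<\<bar>u i\<bar>}" "(k - k') *s d \<in> simplex_lattice i" for k k'
  proof (rule ccontr)
    assume "k \<noteq> k'"
    then have "\<bar>u i\<bar> \<le> \<bar>k - k'\<bar>"
      using simplex_lattice_multiple[OF assms(1-3) that(3)[unfolded d_def]] by (intro dvd_imp_le_int) auto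
    then show False using that(1,2) by auto
  qed
  have r_unique: "r = r'" if "r \<in> R" "r' \<in> R" "- r + x \<in> ?L" "- r' + x \<in> ?L" for r r' x
    using R that unfolding tiles_def by blast
  have diff: "(k - k') *s d = k *s d - k' *s d" for k k' by (simp add: vec_eq_iff left_diff_distrib)
  have zero: "0 \<in> simplex_lattice i"
    unfolding simplex_lattice_def by (rule image_eqI[of _ _ "\<lambda>_. 0"]) (auto simp: weighted_sum_def)
  show "inj_on t (R \<times> {0..<\<bar>u i\<bar>})"
  proof (rule inj_onI, clarify)
    fix r k r' k' assume rk: "r \<in> R" "k \<in> {0..<\<bar>u i\<bar>}" "r' \<in> R" "k' \<in> {0..<\<bar>u i\<bar>}"
      and "t (r, k) = t (r', k')"
    then have eq: "r + k *s d = r' + k' *s d" by (simp add: t)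
    have "- r + (r + k *s d) \<in> ?L" using dL by simp
    moreover have "- r' + (r + k *s d) \<in> ?L" unfolding eq using dL by simp
    ultimately have r: "r = r'" using r_unique rk by blast
    then have "(k - k') *s d = 0" using eq by (simp add: diff)
    then have "k = k'" using zero by (intro k_unique rk) simp
    with r show "r = r' \<and> k = k'" by simp
  qed
  show "tiles (simplex_lattice i) (t ` (R \<times> {0..<\<bar>u i\<bar>}))"
    unfolding tiles_def
  proof (intro allI ex_ex1I)
    fix z
    obtain r where r: "r \<in> R" "- r + z \<in> ?L" using R unfolding tiles_def by blast
    from simplex_lattice_coset[OF assms(1-4) r(2), folded d_def] obtain k where
      k: "k \<in> {0..<\<bar>u i\<bar>}" "- r + z - k *s d \<in> simplex_lattice i" by blast
    have "- (- r + z - k *s d) + z = t (r, k)" by (simp add: t)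
    with r k show "\<exists>l. l \<in> simplex_lattice i \<and> - l + z \<in> t ` (R \<times> {0..<\<bar>u i\<bar>})"
      by (metis SigmaI imageI)
  next
    fix z l l'
    assume l: "l \<in> simplex_lattice i \<and> - l + z \<in> t ` (R \<times> {0..<\<bar>u i\<bar>})"
      and l': "l' \<in> simplex_lattice i \<and> - l' + z \<in> t ` (R \<times> {0..<\<bar>u i\<bar>})"
    from l obtain r k where rk: "r \<in> R" "k \<in> {0..<\<bar>u i\<bar>}" "- l + z = r + k *s d" by (auto simp: t)
    from l' obtain r' k' where rk': "r' \<in> R" "k' \<in> {0..<\<bar>u i\<bar>}" "- l' + z = r' + k' *s d" by (auto simp: t)
    have z: "- r + z = l + k *s d" "- r' + z = l' + k' *s d"
      using rk(3) rk'(3) by (simp_all add: algebra_simps)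
    have "l \<in> ?L" "l' \<in> ?L" using l l' simplex_lattice_subset by blast+
    then have "- r + z \<in> ?L" "- r' + z \<in> ?L" unfolding z using difference_group_ops(3) dL by blast+
    then have "r = r'" using r_unique rk(1) rk'(1) by blast
    then have e: "l + k *s d = l' + k' *s d" using z by simp
    then have "(k - k') *s d = l' - l" by (simp add: diff algebra_simps)
    then have "(k - k') *s d \<in> simplex_lattice i" using simplex_lattice_diff l l' by simp
    then have "k = k'" using k_unique rk(2) rk'(2) by blast
    with e show "l = l'" by simp
  qed
qed

text \<open>
  The linear map that sends the standard basis to the edges from \<open>j\<close> to the other vertices, enumerated
  by \<open>\<sigma>\<close>.
\<close>

definition edge_map :: "nat ^ 'n \<Rightarrow> ('n \<Rightarrow> nat ^ 'n) \<Rightarrow> real ^ 'n \<Rightarrow> real ^ 'n" where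
  "edge_map j \<sigma> x = (\<Sum>k\<in>UNIV. x $ k *\<^sub>R (real_vec (\<sigma> k) - real_vec j))"

lemma linear_edge_map: "linear (edge_map j \<sigma>)"
  by (rule linearI)
    (simp_all add: edge_map_def scaleR_left_distrib sum.distrib scaleR_sum_right)

context
  fixes i j :: "nat ^ 'n" and \<sigma> :: "'n \<Rightarrow> nat ^ 'n"
  assumes i: "i \<in> A" and j: "j \<in> A" and ij: "i \<noteq> j" and ui: "u i \<noteq> 0"
    and \<sigma>: "bij_betw \<sigma> UNIV (A - {i, j})"
begin

lemma sum_remove_vertex: "(\<Sum>a\<in>A - {i}. g a) = g j + (\<Sum>k\<in>UNIV. g (\<sigma> k))" for g :: "nat ^ 'n \<Rightarrow> 'b::comm_monoid_add"
proof -
  have "A - {i} - {j} = A - {i, j}" by blast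
  then have "(\<Sum>a\<in>A - {i}. g a) = g j + (\<Sum>a\<in>A - {i, j}. g a)"
    using finite_A j ij by (simp add: sum.remove[of "A - {i}" j])
  also have "(\<Sum>a\<in>A - {i, j}. g a) = (\<Sum>k\<in>UNIV. g (\<sigma> k))"
    by (rule sum.reindex_bij_betw[OF \<sigma>, symmetric])
  finally show ?thesis .
qed

lemma edge_map_eq:
  assumes "(\<Sum>a\<in>A - {i}. c a) = 0"
  shows "edge_map j \<sigma> (\<chi> k. c (\<sigma> k)) = (\<Sum>a\<in>A - {i}. c a *\<^sub>R real_vec a)"
proof -
  have "c j = - (\<Sum>k\<in>UNIV. c (\<sigma> k))" using assms unfolding sum_remove_vertex by (simp add: eq_neg_iff_add_eq_0)
  then show ?thesis
    unfolding sum_remove_vertex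
    by (simp add: edge_map_def scaleR_diff_right sum_subtractf scaleR_sum_left)
qed

lemma vertex_neq: "\<sigma> k \<noteq> j" "\<sigma> k \<noteq> i" "\<sigma> k \<in> A"
  using \<sigma> by (auto simp: bij_betw_def)

lemma vertex_inv: "inv_into UNIV \<sigma> (\<sigma> k) = k"
  using \<sigma> by (simp add: bij_betw_def)

lemma inj_edge_map: "inj (edge_map j \<sigma>)"
proof (subst linear_injective_0[OF linear_edge_map], intro allI impI)
  fix x assume x: "edge_map j \<sigma> x = 0"
  define c where "c = (\<lambda>a. if a = j then - (\<Sum>k\<in>UNIV. x $ k) else x $ inv_into UNIV \<sigma> a)"
  have c: "c (\<sigma> k) = x $ k" for k by (simp add: c_def vertex_neq vertex_inv)
  have s: "(\<Sum>a\<in>A - {i}. c a) = 0" unfolding sum_remove_vertex c by (simp add: c_def)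
  from edge_map_eq[OF s] have "(\<Sum>a\<in>A - {i}. c a *\<^sub>R real_vec a) = 0" using x by (simp add: c)
  then have "c (\<sigma> k) = 0" for k
    using affine_relation_eq_0[OF _ affine_independent_remove[OF finite_A card_A full_dim u_rel ui] s, of "\<sigma> k"]
      finite_A vertex_neq by auto
  then show "x = 0" by (simp add: c vec_eq_iff)
qed

lemma edge_map_int_vec:
  assumes "(\<Sum>a\<in>A. v a) = 0" "v i = 0"
  shows "edge_map j \<sigma> (real_of_int_vec (\<chi> k. v (\<sigma> k))) = real_of_int_vec (weighted_sum A v)"
proof -
  have "(\<Sum>a\<in>A - {i}. v a) = 0" using assms finite_A i by (simp add: sum.remove)
  then have "(\<Sum>a\<in>A - {i}. real_of_int (v a)) = 0" by (simp flip: of_int_sum)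
  from edge_map_eq[OF this]
  have "edge_map j \<sigma> (real_of_int_vec (\<chi> k. v (\<sigma> k))) = (\<Sum>a\<in>A - {i}. real_of_int (v a) *\<^sub>R real_vec a)"
    by (simp add: real_of_int_vec_def)
  also have "\<dots> = (\<Sum>a\<in>A. real_of_int (v a) *\<^sub>R real_vec a)"
    using assms(2) finite_A i by (simp add: sum.remove)
  also have "\<dots> = real_of_int_vec (weighted_sum A v)"
    by (simp add: vec_eq_iff real_of_int_vec_def weighted_sum_component real_vec_def)
  finally show ?thesis .
qed

lemma edge_map_lattice: "edge_map j \<sigma> ` range real_of_int_vec = real_of_int_vec ` simplex_lattice i"
proof (intro equalityI subsetI)
  fix x assume "x \<in> edge_map j \<sigma> ` range real_of_int_vec"
  then obtain z where z: "x = edge_map j \<sigma> (real_of_int_vec z)" by blast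
  define v where "v = (\<lambda>a. if a = i then 0 else if a = j then - (\<Sum>k\<in>UNIV. z $ k) else z $ inv_into UNIV \<sigma> a)"
  have v: "v (\<sigma> k) = z $ k" for k by (simp add: v_def vertex_neq vertex_inv)
  have "(\<Sum>a\<in>A - {i}. v a) = 0" unfolding sum_remove_vertex v using ij by (simp add: v_def)
  then have s: "(\<Sum>a\<in>A. v a) = 0" "v i = 0" using finite_A i by (simp_all add: sum.remove v_def)
  from edge_map_int_vec[OF s] have "x = real_of_int_vec (weighted_sum A v)"
    by (simp add: v z vec_lambda_eta)
  with s show "x \<in> real_of_int_vec ` simplex_lattice i" unfolding simplex_lattice_def by blast
next
  fix x assume "x \<in> real_of_int_vec ` simplex_lattice i"
  then obtain v where "(\<Sum>a\<in>A. v a) = 0" "v i = 0" "x = real_of_int_vec (weighted_sum A v)"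
    by (auto simp: simplex_lattice_def)
  with edge_map_int_vec show "x \<in> edge_map j \<sigma> ` range real_of_int_vec" by (metis imageI rangeI)
qed

lemma simplex_eq_image:
  "convex hull (real_vec ` (A - {i}))
    = (+) (real_vec j) ` edge_map j \<sigma> ` (convex hull (insert 0 Basis))"
proof -
  have ax: "edge_map j \<sigma> (axis k 1) = real_vec (\<sigma> k) - real_vec j" for k
    by (simp add: edge_map_def axis_def if_distrib[of "\<lambda>c. c *\<^sub>R _"] cong: if_cong)
  have "A - {i} = insert j (range \<sigma>)" using \<sigma> j ij by (auto simp: bij_betw_def)
  then have "real_vec ` (A - {i}) = (+) (real_vec j) ` edge_map j \<sigma> ` (insert 0 Basis)"
    using linear_0[OF linear_edge_map] by (auto simp: image_iff Basis_vec_def ax)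
  then show ?thesis
    by (simp only: convex_hull_translation convex_hull_linear_image[OF linear_edge_map])
qed

end

text \<open>
  The edge map carries the unit cube to a fundamental parallelepiped of the simplex lattice, of volume
  \<open>m \<bar>u i\<bar>\<close> for \<open>m\<close> the index of the difference group, and the standard simplex, of volume \<open>1 / n!\<close>, to a translate of the given one. Finiteness of
  the index is obtained along the way, as the image of the standard simplex is bounded.
\<close>

lemma simplex_volume:
  assumes "i \<in> A" "u i \<noteq> 0"
  shows "measure lborel (convex hull (real_vec ` (A - {i})))
      = real (subgroup_index (difference_group A)) * real_of_int \<bar>u i\<bar> / fact CARD('n)"
    and "subgroup_index (difference_group A) > 0"
proof -
  have "card (A - {i}) = CARD('n) + 1" using finite_A card_A assms(1) by simp
  then obtain j where j: "j \<in> A" "i \<noteq> j"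
    by (metis DiffE One_nat_def add_is_0 card.empty ex_in_conv insertI1 nat.distinct(1))
  have "card (UNIV :: 'n set) = card (A - {i, j})"
    using finite_A card_A assms(1) j by (simp add: card_Diff_subset)
  then obtain \<sigma> where \<sigma>: "bij_betw \<sigma> (UNIV :: 'n set) (A - {i, j})"
    using finite_same_card_bij[of "UNIV :: 'n set" "A - {i, j}"] finite_A by auto
  note ctx = assms(1) j assms(2) \<sigma>
  obtain R where R: "tiles R (difference_group A)" "card R = subgroup_index (difference_group A)"
    using ex_coset_representatives[OF difference_group_ops(1,2)] by blast
  let ?K = "{0..<\<bar>u i\<bar>}"
  define t where "t = (\<lambda>(r, k). r + k *s (int_vec i - int_vec j))"
  have inj: "inj_on t (R \<times> ?K)" and T: "tiles (simplex_lattice i) (t ` (R \<times> ?K))"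
    using simplex_lattice_transversal[OF ctx(1-4) R(1)] unfolding t_def by blast+
  let ?f = "edge_map j \<sigma>" and ?C = "half_open_cube :: (real ^ 'n) set"
  let ?S = "convex hull (insert 0 Basis) :: (real ^ 'n) set"
  note f = linear_edge_map[of j \<sigma>] inj_edge_map[OF ctx]
  have fC: "emeasure lborel (?f ` ?C) = emeasure (count_space UNIV) (t ` (R \<times> ?K))"
    by (rule emeasure_image_cube_eq_card_transversal[OF f edge_map_lattice[OF ctx] T])
  have cS: "compact ?S" by (intro finite_imp_compact_convex_hull) simp
  have cfS: "compact (?f ` ?S)"
    using cS f(1) by (intro compact_continuous_image linear_continuous_on) (simp_all add: linear_conv_bounded_linear)
  have "emeasure lborel ?C * emeasure lborel (?f ` ?S) = emeasure lborel (?f ` ?C) * emeasure lborel ?S"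
    by (rule emeasure_linear_image(2)[OF f]) (simp_all add: borel_compact cS)
  then have fS: "emeasure lborel (?f ` ?S) = emeasure (count_space UNIV) (t ` (R \<times> ?K)) * ennreal (1 / fact CARD('n))"
    by (simp add: emeasure_half_open_cube fC emeasure_std_simplex)
  have "emeasure lborel (?f ` ?S) < \<infinity>"
    using emeasure_compact_finite[OF cfS] by simp
  moreover have "ennreal (1 / fact CARD('n)) \<noteq> 0" by (simp add: ennreal_eq_0_iff not_le)
  ultimately have finT: "finite (t ` (R \<times> ?K))"
    unfolding fS by (cases "finite (t ` (R \<times> ?K))") (auto simp: ennreal_top_mult)
  have "finite (R \<times> ?K)" using finT inj by (rule finite_imageD)
  moreover have K: "?K \<noteq> {}" using assms(2) by simp
  ultimately have finR: "finite R" by (auto dest: finite_cartesian_productD1)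
  have "card (t ` (R \<times> ?K)) = card R * nat \<bar>u i\<bar>"
    using inj by (simp add: card_image card_cartesian_product)
  then have "measure lborel (?f ` ?S) = real (card R) * real (nat \<bar>u i\<bar>) / fact CARD('n)"
    unfolding measure_def fS using finT by (simp add: enn2real_mult ennreal_of_nat_eq_real_of_nat)
  moreover have "measure lborel ((+) (real_vec j) ` ?f ` ?S) = measure lborel (?f ` ?S)"
  proof -
    have "x \<in> (+) (real_vec j) ` ?f ` ?S" if "- real_vec j + x \<in> ?f ` ?S" for x
      using that by (rule rev_image_eqI) simp
    moreover have "- real_vec j + x \<in> ?f ` ?S" if "x \<in> (+) (real_vec j) ` ?f ` ?S" for x
      using that by (elim imageE[where f = "(+) (real_vec j)"]) simp
    ultimately have "(+) (real_vec j) ` ?f ` ?S = {x. - real_vec j + x \<in> ?f ` ?S}"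
      by (intro set_eqI iffI) (simp_all only: mem_Collect_eq)
    then show ?thesis
      unfolding measure_def by (simp only: emeasure_lborel_translate[OF borel_compact[OF cfS]])
  qed
  ultimately show "measure lborel (convex hull (real_vec ` (A - {i})))
      = real (subgroup_index (difference_group A)) * real_of_int \<bar>u i\<bar> / fact CARD('n)"
    unfolding simplex_eq_image[OF ctx] by (simp add: R(2))
  have "R \<noteq> {}" using R(1) by (auto simp: tiles_def)
  then show "subgroup_index (difference_group A) > 0" using finR R(2) by (metis card_gt_0_iff)
qed

end

section \<open>The triangulation of the convex hull\<close>

lemma mem_convex_hull_iff:
  fixes A :: "(nat ^ 'n) set"
  assumes "finite A" "S \<subseteq> A"
  shows "x \<in> convex hull (real_vec ` S) \<longleftrightarrow>
    (\<exists>c. (\<forall>a\<in>A. 0 \<le> c a) \<and> (\<forall>a\<in>A - S. c a = 0) \<and> (\<Sum>a\<in>A. c a) = 1 \<and> (\<Sum>a\<in>A. c a *\<^sub>R real_vec a) = x)"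
    (is "_ \<longleftrightarrow> ?R")
proof -
  have inj: "inj_on real_vec S" using inj_real_vec inj_on_subset by blast
  have fin: "finite S" using assms finite_subset by blast
  have restrict: "(\<Sum>a\<in>A. c a) = (\<Sum>a\<in>S. c a)" "(\<Sum>a\<in>A. c a *\<^sub>R real_vec a) = (\<Sum>a\<in>S. c a *\<^sub>R real_vec a)"
    if "\<forall>a\<in>A - S. c a = 0" for c :: "nat ^ 'n \<Rightarrow> real"
    using assms that by (auto intro!: sum.mono_neutral_right)
  have "x \<in> convex hull (real_vec ` S) \<longleftrightarrow>
    (\<exists>c. (\<forall>a\<in>S. 0 \<le> c (real_vec a)) \<and> (\<Sum>a\<in>S. c (real_vec a)) = 1 \<and> (\<Sum>a\<in>S. c (real_vec a) *\<^sub>R real_vec a) = x)"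
    using fin by (simp add: convex_hull_finite sum.reindex[OF inj] o_def)
  also have "\<dots> \<longleftrightarrow> ?R"
  proof
    assume "\<exists>c. (\<forall>a\<in>S. 0 \<le> c (real_vec a)) \<and> (\<Sum>a\<in>S. c (real_vec a)) = 1 \<and> (\<Sum>a\<in>S. c (real_vec a) *\<^sub>R real_vec a) = x"
    then obtain c where c: "\<forall>a\<in>S. 0 \<le> c (real_vec a)" "(\<Sum>a\<in>S. c (real_vec a)) = 1"
      "(\<Sum>a\<in>S. c (real_vec a) *\<^sub>R real_vec a) = x" by blast
    let ?c = "\<lambda>a. if a \<in> S then c (real_vec a) else 0"
    have "(\<Sum>a\<in>A. ?c a) = 1" "(\<Sum>a\<in>A. ?c a *\<^sub>R real_vec a) = x"
      using c restrict[of ?c] by simp_all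
    with c(1) show ?R by (intro exI[of _ ?c]) auto
  next
    assume ?R
    then obtain c where c: "\<forall>a\<in>A. 0 \<le> c a" "\<forall>a\<in>A - S. c a = 0" "(\<Sum>a\<in>A. c a) = 1"
      "(\<Sum>a\<in>A. c a *\<^sub>R real_vec a) = x" by blast
    with restrict[OF c(2)] assms(2)
    show "\<exists>c. (\<forall>a\<in>S. 0 \<le> c (real_vec a)) \<and> (\<Sum>a\<in>S. c (real_vec a)) = 1 \<and> (\<Sum>a\<in>S. c (real_vec a) *\<^sub>R real_vec a) = x"
      by (intro exI[of _ "\<lambda>v. c (inv real_vec v)"]) (auto simp: inv_f_f[OF inj_real_vec])
  qed
  finally show ?thesis .
qed

lemma negligible_convex_hull_few_points:
  fixes S :: "(real ^ 'n) set"
  assumes "finite S" "card S \<le> CARD('n)"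
  shows "negligible (convex hull S)"
proof -
  have "aff_dim (convex hull S) < DIM(real ^ 'n)"
    using aff_dim_le_card[OF assms(1)] assms(2) by (simp add: aff_dim_convex_hull)
  then obtain h b where "h \<noteq> 0" "convex hull S \<subseteq> {x. h \<bullet> x = b}"
    by (rule aff_lowdim_subset_hyperplane)
  then show ?thesis using negligible_hyperplane[of h b] negligible_subset by blast
qed

context single_relation
begin

lemma real_relation_multiple:
  fixes c :: "nat ^ 'n \<Rightarrow> real"
  assumes "(\<Sum>a\<in>A. c a) = 0" "(\<Sum>a\<in>A. c a *\<^sub>R real_vec a) = 0" and "i \<in> A" "u i \<noteq> 0" "a \<in> A"
  shows "c a = c i / u i * u a"
proof -
  define s where "s = c i / u i"
  define w where "w = (\<lambda>a. c a - s * u a)"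
  have wi: "w i = 0" using assms(4) by (simp add: w_def s_def)
  note r = affine_relation_real[OF u_rel]
  have "(\<Sum>a\<in>A. w a) = 0"
    using assms(1) r(1) by (simp add: w_def sum_subtractf flip: sum_distrib_left)
  then have w1: "(\<Sum>a\<in>A - {i}. w a) = 0" using finite_A assms(3) wi by (simp add: sum.remove)
  have "(\<Sum>a\<in>A. w a *\<^sub>R real_vec a) = (\<Sum>a\<in>A. c a *\<^sub>R real_vec a) - s *\<^sub>R (\<Sum>a\<in>A. real_of_int (u a) *\<^sub>R real_vec a)"
    by (simp add: w_def scaleR_diff_left sum_subtractf scaleR_sum_right)
  then have "(\<Sum>a\<in>A. w a *\<^sub>R real_vec a) = 0" using assms(2) r(2) by simp
  then have w2: "(\<Sum>a\<in>A - {i}. w a *\<^sub>R real_vec a) = 0" using finite_A assms(3) wi by (simp add: sum.remove)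
  have "w a = 0"
  proof (cases "a = i")
    case False
    then show ?thesis
      using affine_relation_eq_0[OF _ affine_independent_remove[OF finite_A card_A full_dim u_rel assms(4)] w1 w2]
        finite_A assms(5) by simp
  qed (simp add: wi)
  then show ?thesis by (simp add: w_def s_def)
qed

definition positive_points :: "(nat ^ 'n) set" where
  "positive_points = {a \<in> A. u a > 0}"

lemma positive_points: "finite positive_points" "positive_points \<noteq> {}" "positive_points \<subseteq> A"
  using finite_A ex_positive by (auto simp: positive_points_def)

text \<open>
  Starting from a convex combination, subtract the relation \<open>u\<close> until the first coefficient reaches zero.
  Only coefficients at points where \<open>u\<close> is positive decrease, and the ratio test selects the one that
  vanishes first.
\<close>

lemma convex_hull_eq_Union_simplices:
  "convex hull (real_vec ` A) = (\<Union>i\<in>positive_points. convex hull (real_vec ` (A - {i})))"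
proof (intro equalityI subsetI)
  fix x assume "x \<in> convex hull (real_vec ` A)"
  then obtain c where c: "\<forall>a\<in>A. 0 \<le> c a" "(\<Sum>a\<in>A. c a) = 1" "(\<Sum>a\<in>A. c a *\<^sub>R real_vec a) = x"
    by (auto simp: mem_convex_hull_iff[OF finite_A order_refl])
  define i where "i = arg_min_on (\<lambda>a. c a / u a) positive_points"
  have i: "i \<in> positive_points"
    unfolding i_def by (rule arg_min_if_finite(1)) (use positive_points in auto)
  have min: "c i / u i \<le> c a / u a" if "a \<in> positive_points" for a
    unfolding i_def by (rule arg_min_least) (use positive_points that in auto)
  have iA: "i \<in> A" "u i > 0" using i by (auto simp: positive_points_def)
  define s where "s = c i / u i"
  have s0: "s \<ge> 0" using c(1) iA by (simp add: s_def)
  define c' where "c' = (\<lambda>a. c a - s * u a)"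
  have "0 \<le> c' a" if "a \<in> A" for a
  proof (cases "u a > 0")
    case True
    then have "s \<le> c a / u a" using min[of a] that by (simp add: s_def positive_points_def)
    then show ?thesis using True by (simp add: c'_def pos_le_divide_eq)
  next
    case False
    then have "s * u a \<le> 0" using s0 by (simp add: mult_nonneg_nonpos)
    moreover have "0 \<le> c a" using c(1) that by blast
    ultimately show ?thesis by (simp add: c'_def)
  qed
  moreover have "c' i = 0" using iA by (simp add: c'_def s_def)
  moreover have "(\<Sum>a\<in>A. c' a) = 1"
    using c(2) affine_relation_real(1)[OF u_rel] by (simp add: c'_def sum_subtractf flip: sum_distrib_left)
  moreover have "(\<Sum>a\<in>A. c' a *\<^sub>R real_vec a) = x"
  proof -
    have "(\<Sum>a\<in>A. c' a *\<^sub>R real_vec a) = (\<Sum>a\<in>A. c a *\<^sub>R real_vec a) - s *\<^sub>R (\<Sum>a\<in>A. real_of_int (u a) *\<^sub>R real_vec a)"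
      by (simp add: c'_def scaleR_diff_left sum_subtractf scaleR_sum_right)
    then show ?thesis using c(3) affine_relation_real(2)[OF u_rel] by simp
  qed
  ultimately have "x \<in> convex hull (real_vec ` (A - {i}))"
    by (subst mem_convex_hull_iff[OF finite_A Diff_subset]) (intro exI[of _ c'], auto)
  with i show "x \<in> (\<Union>i\<in>positive_points. convex hull (real_vec ` (A - {i})))" by blast
next
  fix x assume "x \<in> (\<Union>i\<in>positive_points. convex hull (real_vec ` (A - {i})))"
  then obtain i where "x \<in> convex hull (real_vec ` (A - {i}))" by blast
  moreover have "convex hull (real_vec ` (A - {i})) \<subseteq> convex hull (real_vec ` A)"
    by (intro hull_mono image_mono) auto
  ultimately show "x \<in> convex hull (real_vec ` A)" by blast
qed

text \<open>
  Two convex combinations of the same point differ by a multiple of \<open>u\<close>. Vanishing of one coefficient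
  of each forces this multiple to be both nonnegative and nonpositive.
\<close>

lemma simplices_Int_subset:
  assumes "i \<in> positive_points" "j \<in> positive_points" "i \<noteq> j"
  shows "convex hull (real_vec ` (A - {i})) \<inter> convex hull (real_vec ` (A - {j}))
    \<subseteq> convex hull (real_vec ` (A - {i, j}))"
proof
  have i: "i \<in> A" "u i > 0" and j: "j \<in> A" "u j > 0" using assms by (auto simp: positive_points_def)
  fix x assume "x \<in> convex hull (real_vec ` (A - {i})) \<inter> convex hull (real_vec ` (A - {j}))"
  then obtain c c' where c: "\<forall>a\<in>A. 0 \<le> c a" "c i = 0" "(\<Sum>a\<in>A. c a) = 1" "(\<Sum>a\<in>A. c a *\<^sub>R real_vec a) = x"
    and c': "\<forall>a\<in>A. 0 \<le> c' a" "c' j = 0" "(\<Sum>a\<in>A. c' a) = 1" "(\<Sum>a\<in>A. c' a *\<^sub>R real_vec a) = x"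
    using i(1) j(1) by (auto simp: mem_convex_hull_iff[OF finite_A Diff_subset])
  have "(\<Sum>a\<in>A. c' a - c a) = 0" "(\<Sum>a\<in>A. (c' a - c a) *\<^sub>R real_vec a) = 0"
    using c c' by (simp_all add: sum_subtractf scaleR_diff_left)
  from real_relation_multiple[OF this i(1) _ j(1)] i(2)
  have "- c j = c' i / u i * u j" using c(2) c'(2) by simp
  moreover have "c' i / u i * u j \<ge> 0" using c'(1) i j by simp
  ultimately have "c j = 0" using c(1) j(1) by force
  then show "x \<in> convex hull (real_vec ` (A - {i, j}))"
    using c by (subst mem_convex_hull_iff[OF finite_A Diff_subset]) (intro exI[of _ c], auto)
qed

text \<open>
  The simplices overlap only in convex hulls of \<open>n\<close> points, which are null sets, so their volumes add up.
\<close>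

theorem relation_degree_eq_volume:
  "real relation_degree = fact CARD('n) * measure lborel (convex hull (real_vec ` A))
      / real (subgroup_index (difference_group A))"
proof -
  let ?m = "real (subgroup_index (difference_group A))"
  have cpt: "compact (convex hull (real_vec ` (A - S)))" for S
    by (intro finite_imp_compact_convex_hull finite_imageI finite_Diff finite_A)
  have leb: "measure lebesgue S = measure lborel S" if "compact S" for S :: "(real ^ 'n) set"
    using borel_compact[OF that] by simp
  have "measure lborel (convex hull (real_vec ` A)) = measure lebesgue (convex hull (real_vec ` A))"
    using leb[OF cpt[of "{}"]] by simp
  also have "\<dots> = (\<Sum>i\<in>positive_points. measure lebesgue (convex hull (real_vec ` (A - {i}))))"
    unfolding convex_hull_eq_Union_simplices
  proof (rule measure_negligible_finite_Union_image)
    show "pairwise (\<lambda>i j. negligible (convex hull (real_vec ` (A - {i})) \<inter> convex hull (real_vec ` (A - {j}))))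
        positive_points"
    proof (rule pairwiseI)
      fix i j assume ij: "i \<in> positive_points" "j \<in> positive_points" "i \<noteq> j"
      have "{i, j} \<subseteq> A" using ij(1,2) positive_points(3) by blast
      then have "card (A - {i, j}) = CARD('n)"
        using ij(3) card_A by (simp add: card_Diff_subset)
      then have "card (real_vec ` (A - {i, j})) \<le> CARD('n)"
        using card_image_le[of "A - {i, j}" real_vec] finite_A by simp
      then have "negligible (convex hull (real_vec ` (A - {i, j})))"
        using finite_A by (intro negligible_convex_hull_few_points) auto
      then show "negligible (convex hull (real_vec ` (A - {i})) \<inter> convex hull (real_vec ` (A - {j})))"
        using simplices_Int_subset[OF ij] negligible_subset by blast
    qed
  qed (auto simp: positive_points lmeasurable_compact cpt)
  also have "\<dots> = (\<Sum>i\<in>positive_points. ?m / fact CARD('n) * real (nat (u i)))"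
    using simplex_volume(1) by (intro sum.cong) (auto simp: leb[OF cpt] positive_points_def)
  also have "\<dots> = ?m / fact CARD('n) * (\<Sum>i\<in>positive_points. real (nat (u i)))"
    by (simp add: sum_distrib_left)
  also have "(\<Sum>i\<in>positive_points. real (nat (u i))) = real relation_degree"
    unfolding relation_degree_def of_nat_sum
    by (intro sum.mono_neutral_left) (auto simp: positive_points_def finite_A)
  finally have "fact CARD('n) * measure lborel (convex hull (real_vec ` A)) = ?m * real relation_degree" by simp
  moreover obtain i where "i \<in> A" "u i > 0" by (rule ex_positive)
  then have "?m \<noteq> 0" using simplex_volume(2)[of i] by simp
  ultimately show ?thesis by simp
qed

end

section \<open>Sumsets, degree and volume\<close>

lemma sumset_poly_eqI:
  assumes "\<And>t. t \<ge> N \<Longrightarrow> of_nat (sumset_card A t) = poly p (of_nat t)"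
  shows "sumset_poly A = p"
  unfolding sumset_poly_def by (rule the_eventual_poly) (rule assms)

theorem proposition3p7:
  fixes A :: "(nat ^ 'n) set"
    and Y :: "(nat ^ 'n \<Rightarrow> 'k::{alg_closed_field, field_char_0}) set set"
    and n :: nat
  assumes "n = CARD('n)"
    and "finite A"
    and "Y = monomial_variety A"
    and "proj_dim A Y = enat n"
  shows "(card A = n + 1 \<longrightarrow>
      (\<forall>t. of_nat (sumset_card A t) = poly (sumset_poly A) (of_nat t) \<and>
           sumset_card A t = (t + n) choose n) \<and>
      phase_transition A = 0) \<and>
    (card A = n + 2 \<longrightarrow>
      (\<exists>d::nat. of_nat d = proj_degree A Y \<and>
        int (phase_transition A) = max 0 (int d - int n - 1) \<and>
        (\<forall>t. int (sumset_card A t) =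
          (if int t < int d - int n - 1
           then int ((t + n + 1) choose (n + 1))
           else int ((t + n + 1) choose (n + 1)) - int ((t + n + 1 - d) choose (n + 1)))) \<and>
        real d = fact n * measure lborel (convex hull (real_vec ` A))
                   / real (subgroup_index (difference_group A))))"
proof (intro conjI impI)
  assume card: "card A = n + 1"
  then have "A \<noteq> {}" by auto
  then have full: "aff_dim (real_vec ` A) = CARD('n)"
    using aff_dim_eq_if_proj_dim_eq[OF assms(2)] assms(1,3,4) by blast
  have inj: "inj_on real_vec A" using inj_real_vec inj_on_subset by blast
  have "\<not> affine_dependent (real_vec ` A)"
    using full card assms(1,2) by (simp add: affine_independent_iff_card card_image[OF inj])
  from card_sumset_if_affine_independent[OF assms(2) this]
  have count: "sumset_card A t = (t + n) choose n" for t
    using card assms(1) by (simp add: sumset_card_def)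
  have poly_count: "of_nat (sumset_card A t) = poly (gbinomial_poly n (of_nat n)) (of_nat t)" for t
    by (simp add: count poly_gbinomial_poly binomial_gbinomial)
  then have p: "sumset_poly A = gbinomial_poly n (of_nat n)"
    by (intro sumset_poly_eqI[of 0])
  show "\<forall>t. of_nat (sumset_card A t) = poly (sumset_poly A) (of_nat t) \<and> sumset_card A t = (t + n) choose n"
    using poly_count count p by simp
  show "phase_transition A = 0"
    unfolding phase_transition_def by (rule Least_eq_0) (simp add: poly_count p)
next
  assume card: "card A = n + 2"
  then have ne: "A \<noteq> {}" by auto
  then have full: "aff_dim (real_vec ` A) = CARD('n)"
    using aff_dim_eq_if_proj_dim_eq[OF assms(2)] assms(1,3,4) by blast
  obtain u where u: "u \<in> affine_relations A" "u \<noteq> (\<lambda>_. 0)"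
    "\<And>v. v \<in> affine_relations A \<Longrightarrow> \<exists>q. v = (\<lambda>a. q * u a)"
    using affine_relations_generator[OF assms(2) _ full] card assms(1) by auto
  interpret single_relation A u
    by unfold_locales (use assms(1,2) card full u in auto)
  define d where "d = relation_degree"
  have d0: "d > 0" using relation_degree_pos by (simp add: d_def)
  note count = card_sumset[folded d_def assms(1) sumset_card_def]
  have poly_count: "of_nat (sumset_card A t) = poly (difference_poly n d) (of_nat t)" if "d \<le> t + n + 1" for t
    using of_nat_difference_binomial[OF that] count(2)[of t]
    by (simp add: count(1) of_nat_diff)
  have p: "sumset_poly A = difference_poly n d"
    by (rule sumset_poly_eqI[of d]) (rule poly_count, simp)
  have "hilbert_poly A Y = difference_poly n d"
    unfolding hilbert_poly_def assms(3) hilbert_function_monomial_variety[OF assms(2) ne] sumset_card_def[symmetric]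
    by (rule the_eventual_poly[of d]) (rule poly_count, simp)
  then have deg: "of_nat d = proj_degree A Y"
    using difference_poly_degree[OF d0, of n] by (simp add: proj_degree_def)
  have phase: "phase_transition A = d - (n + 1)"
    unfolding phase_transition_def p
  proof (rule Least_equality)
    show "\<forall>t\<ge>d - (n + 1). of_nat (sumset_card A t) = poly (difference_poly n d) (of_nat t)"
      using poly_count by simp
    fix N assume N: "\<forall>t\<ge>N. of_nat (sumset_card A t) = poly (difference_poly n d) (of_nat t)"
    show "d - (n + 1) \<le> N"
    proof (rule ccontr)
      \<comment> \<open>Then \<open>d \<ge> n + 2\<close>, and the last argument before the transition is at least \<open>N\<close>.\<close>
      assume "\<not> d - (n + 1) \<le> N"
      then obtain t where t: "d = t + n + 2" "t \<ge> N"
        by (intro that[of "d - (n + 2)"]) auto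
      then have s: "sumset_card A t = (t + n + 1) choose (n + 1)"
        by (simp add: count(1) binomial_eq_0)
      have "of_nat (sumset_card A t) = poly (difference_poly n d) (of_nat t)" using N t(2) by blast
      then show False using poly_difference_poly_before[OF t(1)] by (simp only: s)
    qed
  qed
  show "\<exists>d::nat. of_nat d = proj_degree A Y \<and>
        int (phase_transition A) = max 0 (int d - int n - 1) \<and>
        (\<forall>t. int (sumset_card A t) =
          (if int t < int d - int n - 1
           then int ((t + n + 1) choose (n + 1))
           else int ((t + n + 1) choose (n + 1)) - int ((t + n + 1 - d) choose (n + 1)))) \<and>
        real d = fact n * measure lborel (convex hull (real_vec ` A))
                   / real (subgroup_index (difference_group A))"
  proof (intro exI conjI allI)
    show "of_nat d = proj_degree A Y" by (rule deg)
    show "int (phase_transition A) = max 0 (int d - int n - 1)" by (simp add: phase)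
    show "real d = fact n * measure lborel (convex hull (real_vec ` A)) / real (subgroup_index (difference_group A))"
      using relation_degree_eq_volume by (simp add: d_def assms(1))
    fix t
    have "int (sumset_card A t) = int ((t + n + 1) choose (n + 1)) - int ((t + n + 1 - d) choose (n + 1))"
      unfolding count(1) by (rule of_nat_diff[OF count(2)])
    moreover have "(t + n + 1 - d) choose (n + 1) = 0" if "int t < int d - int n - 1"
      using that by (intro binomial_eq_0) simp
    ultimately show "int (sumset_card A t) =
          (if int t < int d - int n - 1
           then int ((t + n + 1) choose (n + 1))
           else int ((t + n + 1) choose (n + 1)) - int ((t + n + 1 - d) choose (n + 1)))"
      by simp
  qed
qed

end
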